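(* Let $Y=XA+E$ with $X\in\mathbb R^{m\times p}$ and $A\in\mathbb R^{p\times n}$ fixed, and $E$ an $m\times n$ random matrix with independent $N(0,\sigma^2)$ entries. Let $B_1,B_2,\ldots$ be any (countable) collection of nonzero $p\times n$ matrices, which may be random (in particular may depend on the data $Y$), and let $\widetilde B$ be a minimizer of $\|Y-XB_j\|_F^2+\operatorname{pen}(B_j)$ over the collection $\{B_j\}$, where $\operatorname{pen}$ is the penalty defined in the context with constant $c=12$. Then $$\mathbb E\big[\|XA-X\widetilde B\|_F^2\big]\le \inf_j\Big\{10\,\mathbb E\big[\|XA-XB_j\|_F^2\big]+8\,\mathbb E\big[\operatorname{pen}(B_j)\big]\Big\}+768\,n\,\sigma^2\exp(-n/2).$$
   Context: $\|\cdot\|_F$ is the Frobenius norm. For a $p\times n$ matrix $B$, $r(B)$ denotes its rank, $J(B)\subseteq\{1,\dots,p\}$ the set of indices of its nonzero rows, and $|J(B)|$ the cardinality of this set. The penalty is $$\operatorname{pen}(B)=c\,\sigma^2\, r(B)\Big\{2n+\log(2e)\,|J(B)|+|J(B)|\log\Big(\frac{ep}{|J(B)|}\Big)\Big\}.$$ *)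

theory Defs
  imports "HOL-Probability.Probability"
begin

text \<open>A \<open>p \<times> n\<close> matrix has type \<open>real^'n^'p\<close>, with \<open>p = CARD('p)\<close> and \<open>n = CARD('n)\<close>.
  Its library norm is the Euclidean norm of the vector of Euclidean row norms,
  that is, the Frobenius norm.\<close>

lemma norm_eq_frobenius:
  fixes B :: "real^'n^'p"
  shows "norm B = sqrt (\<Sum>i\<in>UNIV. \<Sum>j\<in>UNIV. (B $ i $ j)\<^sup>2)"
  by (simp add: norm_vec_def L2_set_def sum_nonneg)

definition nonzero_rows :: "real^'n^'p \<Rightarrow> 'p set" where
  "nonzero_rows B = {i. row i B \<noteq> 0}"

definition pen :: "real \<Rightarrow> real \<Rightarrow> real^'n^'p \<Rightarrow> real" where
  "pen c \<sigma> B = c * \<sigma>\<^sup>2 * real (rank B) *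
     (2 * real CARD('n)
      + ln (2 * exp 1) * real (card (nonzero_rows B))
      + real (card (nonzero_rows B))
          * ln (exp 1 * real CARD('p) / real (card (nonzero_rows B))))"

text \<open>The penalty is nonnegative, so embedding it into \<^typ>\<open>ennreal\<close> truncates nothing.\<close>

lemma pen_nonneg:
  fixes B :: "real^'n^'p"
  assumes "c \<ge> 0"
  shows "pen c \<sigma> B \<ge> 0"
proof -
  let ?k = "card (nonzero_rows B)"
  have le: "?k \<le> CARD('p)"
    by (intro card_mono) auto
  have "real ?k * ln (exp 1 * real CARD('p) / real ?k) \<ge> 0"
  proof (cases "?k = 0")
    case False
    have "real ?k * 1 \<le> real CARD('p) * exp 1"
      using le by (intro mult_mono) auto
    hence "1 \<le> exp 1 * real CARD('p) / real ?k"
      using False by (subst le_divide_eq_1_pos) (auto simp: mult.commute card_gt_0_iff)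
    thus ?thesis by (simp add: ln_ge_zero)
  qed simp
  moreover have "ln (2 * exp (1::real)) \<ge> 0"
    using one_le_exp_iff[of "1::real"] by (intro ln_ge_zero) linarith
  hence "2 * real CARD('n) + ln (2 * exp 1) * real ?k \<ge> 0" by simp
  ultimately have "2 * real CARD('n) + ln (2 * exp 1) * real ?k
      + real ?k * ln (exp 1 * real CARD('p) / real ?k) \<ge> 0"
    by linarith
  moreover have "c * \<sigma>\<^sup>2 * real (rank B) \<ge> 0"
    using assms by simp
  ultimately show ?thesis
    unfolding pen_def by (rule mult_nonneg_nonneg[rotated])
qed

end

theory Submission imports Defs begin

text \<open>
  Write \<open>r\<close> for the rank and \<open>J\<close> for the set of nonzero rows of a matrix, \<open>V\<^sub>K\<close> for the span of the columns
  of \<open>X\<close> with index in \<open>K\<close>, and \<open>\<parallel>w v* E\<parallel>\<^sup>2\<close> for the squared length of the transpose of \<open>E\<close> applied to \<open>w\<close>.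
  Comparing the minimizer \<open>C\<close> with a competitor \<open>B\<close> gives
  \<open>\<parallel>X A - X C\<parallel>\<^sup>2 + pen C \<le> \<parallel>X A - X B\<parallel>\<^sup>2 + pen B + 2 E \<bullet> (X C - X B)\<close>,
  and the point is to absorb the last term, where \<open>B\<close> and \<open>C\<close> may depend on the noise.

  Suppose that \<open>r(B) \<le> r(C)\<close>. The columns of \<open>X C - X B\<close> lie in a space with an
  orthonormal basis of at most \<open>r(C)\<close> vectors of \<open>V\<^sub>K\<close> for \<open>K = J(C)\<close> and at most \<open>r(B)\<close> vectors of \<open>V\<^sub>K\<close>
  for \<open>K = J(B) \<union> J(C)\<close>. By Cauchy-Schwarz it remains to bound \<open>\<parallel>w v* E\<parallel>\<^sup>2\<close> for unit vectors \<open>w\<close> of \<open>V\<^sub>K\<close>, and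
  since the joint support comes with the smaller rank, the resulting thresholds are absorbed by
  \<open>pen B + pen C\<close> (\<open>inner_matrix_difference_le\<close>, \<open>rank_threshold_le_pen\<close>, \<open>penalized_minimizer_loss_le\<close>).

  The norm of the noise on \<open>V\<^sub>K\<close> is controlled uniformly in \<open>K\<close> without Gaussian comparison or
  concentration inequalities. For a fixed unit vector \<open>w\<close>, \<open>exp (\<mu> \<parallel>w v* E\<parallel>\<^sup>2 / \<sigma>\<^sup>2)\<close> has mean
  \<open>(1 - 2 \<mu>)\<^sup>-\<^sup>n\<^sup>/\<^sup>2\<close>. The supremum over the unit ball of \<open>V\<^sub>K\<close> is compared with the average over it: for a
  maximizer \<open>w\<close>, the average of the exponential over the ball of radius \<open>\<epsilon>\<close> about \<open>(1 - \<epsilon>) w\<close> is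
  at least its value at the centre, and this small ball occupies at least a fraction \<open>\<epsilon>\<^sup>k\<close> of the
  unit ball, \<open>k = card K\<close> (\<open>exp_quadratic_le_cylinder_average\<close>, \<open>subspace_exp_moment\<close>). So the price of the
  supremum is \<open>\<mu>\<close> replaced by \<open>\<mu> (1 - \<epsilon>)\<^sup>2\<close> and the factor \<open>\<epsilon>\<^sup>-\<^sup>k\<close>. The latter is paid by
  the term \<open>log (2 e) k\<close> of the penalty, and the sum over all \<open>K\<close> by the term
  \<open>k log (e p / k)\<close>, because there are at most \<open>exp (k log (e p / k))\<close> sets of size \<open>k\<close>
  (\<open>noise_remainder\<close>).
\<close>

section \<open>Suprema of quadratic forms and averages\<close>

text \<open>The coordinate projection \<open>\<pi>\<^sub>K\<close> of \<open>\<real>\<^sup>p\<close> onto the coordinates in \<open>K\<close>, the other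
  coordinates being set to zero.\<close>

definition coord_proj :: "'p set \<Rightarrow> real^'p \<Rightarrow> real^'p" where
  "coord_proj K c = (\<chi> i. if i \<in> K then c $ i else 0)"

lemma linear_coord_proj: "linear (coord_proj K)"
  by (rule linearI) (auto simp: coord_proj_def vec_eq_iff)

lemma coord_proj_idem [simp]: "coord_proj K (coord_proj K c) = coord_proj K c"
  by (auto simp: coord_proj_def vec_eq_iff)

lemma norm_coord_proj_le: "norm (coord_proj K c) \<le> norm c"
  by (auto simp: coord_proj_def intro!: norm_le_componentwise_cart)

lemma norm_diff_coord_proj_le: "norm (c - coord_proj K c) \<le> norm c"
  by (auto simp: coord_proj_def intro!: norm_le_componentwise_cart)

lemma coord_proj_partial_affine:
  assumes "coord_proj K t = t"
  shows "coord_proj K (t + a *\<^sub>R coord_proj K c + (c - coord_proj K c)) = t + a *\<^sub>R coord_proj K c"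
  by (simp add: linear_add[OF linear_coord_proj] linear_diff[OF linear_coord_proj]
      linear_scale[OF linear_coord_proj] assms)

text \<open>Lebesgue measure scales by \<open>\<bar>a\<bar>\<^sup>k\<close>, with \<open>k = card K\<close>, under the affine maps that rescale only the
  coordinates in \<open>K\<close> by \<open>a\<close>.\<close>

lemma nn_integral_lborel_partial_affine:
  fixes f :: "real^'p \<Rightarrow> ennreal"
  assumes f: "f \<in> borel_measurable borel" and a: "a \<noteq> 0"
  shows "(\<integral>\<^sup>+c. f c \<partial>lborel) = ennreal (\<bar>a\<bar> ^ card K) *
    (\<integral>\<^sup>+c. f (t + a *\<^sub>R coord_proj K c + (c - coord_proj K c)) \<partial>lborel)"
proof -
  let ?ax = "\<lambda>i::'p. axis i (1::real)"
  define w where "w j = (if j \<in> ?ax ` K then a else 1)" for j :: "real^'p"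
  define T where "T x = t + (\<Sum>j\<in>Basis. (w j * (x \<bullet> j)) *\<^sub>R j)" for x :: "real^'p"
  have B: "(Basis :: (real^'p) set) = range ?ax"
    by (auto simp: Basis_vec_def)
  have inj: "inj ?ax"
    by (auto simp: inj_def axis_eq_axis)
  have w_ax: "w (?ax i) = (if i \<in> K then a else 1)" for i
    using inj by (auto simp: w_def inj_def)
  have T_eq: "T x = t + a *\<^sub>R coord_proj K x + (x - coord_proj K x)" for x
  proof -
    have "(\<Sum>j\<in>Basis. (w j * (x \<bullet> j)) *\<^sub>R j) = (\<Sum>i\<in>UNIV. (w (?ax i) * x $ i) *\<^sub>R ?ax i)"
      unfolding B by (subst sum.reindex[OF inj]) (simp add: inner_axis)
    also have "\<dots> = a *\<^sub>R coord_proj K x + (x - coord_proj K x)"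
      unfolding w_ax by (auto simp: vec_eq_iff coord_proj_def axis_def if_distrib cong: if_cong)
    finally show ?thesis by (simp add: T_def)
  qed
  have "(\<Prod>j\<in>Basis. \<bar>w j\<bar>) = (\<Prod>i\<in>UNIV. \<bar>w (?ax i)\<bar>)"
    unfolding B by (subst prod.reindex[OF inj]) simp
  also have "\<dots> = (\<Prod>i\<in>UNIV. if i \<in> K then \<bar>a\<bar> else 1)"
    by (auto simp: w_ax intro!: prod.cong)
  also have "\<dots> = \<bar>a\<bar> ^ card K"
    by (simp add: prod.If_cases)
  finally have prod_w: "(\<Prod>j\<in>Basis. \<bar>w j\<bar>) = \<bar>a\<bar> ^ card K" .
  have T_meas: "T \<in> borel_measurable borel"
    unfolding T_def by measurable
  have "lborel = density (distr lborel borel T) (\<lambda>_. ennreal (\<Prod>j\<in>Basis. \<bar>w j\<bar>))"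
    unfolding T_def by (rule lborel_affine_euclidean) (use a in \<open>auto simp: w_def\<close>)
  hence "lborel = density (distr lborel borel T) (\<lambda>_. ennreal (\<bar>a\<bar> ^ card K))"
    by (simp only: prod_w)
  hence "(\<integral>\<^sup>+c. f c \<partial>lborel)
      = (\<integral>\<^sup>+c. f c \<partial>density (distr lborel borel T) (\<lambda>_. ennreal (\<bar>a\<bar> ^ card K)))"
    by simp
  also have "\<dots> = (\<integral>\<^sup>+c. ennreal (\<bar>a\<bar> ^ card K) * f c \<partial>distr lborel borel T)"
    using f by (subst nn_integral_density) auto
  also have "\<dots> = ennreal (\<bar>a\<bar> ^ card K) * (\<integral>\<^sup>+c. f (T c) \<partial>lborel)"
    using f T_meas by (simp add: nn_integral_cmult nn_integral_distr)
  finally show ?thesis by (simp only: T_eq)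
qed

text \<open>The product of the unit ball in the coordinates from \<open>K\<close> with the unit ball in the remaining
  ones. It plays the role of the unit ball of \<open>\<real>\<^sup>k\<close>, \<open>k = card K\<close>, without
  a type of dimension \<open>k\<close>: the functions integrated over it ignore the coordinates outside \<open>K\<close>, whose
  only effect is to contribute a common factor to all volumes.\<close>

definition cylinder :: "'p set \<Rightarrow> (real^'p) set" where
  "cylinder K = {c. norm (coord_proj K c) \<le> 1 \<and> norm (c - coord_proj K c) \<le> 1}"

lemma continuous_coord_proj: "continuous_on S (coord_proj K)"
  using linear_coord_proj linear_continuous_on linear_linear by blast

lemma sets_cylinder [measurable]: "cylinder K \<in> sets borel"
  unfolding cylinder_def
  by (intro borel_closed closed_Collect_conj closed_Collect_le continuous_intros continuous_coord_proj)

lemma emeasure_cylinder_pos: "emeasure lborel (cylinder K) > 0"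
proof -
  have "ball 0 1 \<subseteq> cylinder K"
    unfolding cylinder_def using norm_coord_proj_le norm_diff_coord_proj_le
    by (fastforce intro: order_trans)
  hence "emeasure lborel (ball 0 1 :: (real^'a) set) \<le> emeasure lborel (cylinder K)"
    by (intro emeasure_mono) auto
  moreover have "emeasure lborel (ball 0 1 :: (real^'a) set) \<noteq> 0"
    using open_not_negligible[of "ball 0 1 :: (real^'a) set"]
    by (auto simp: negligible_iff_emeasure0)
  ultimately show ?thesis
    by (metis not_gr_zero le_zero_eq)
qed

lemma emeasure_cylinder_finite: "emeasure lborel (cylinder K) < \<infinity>"
proof -
  have "norm c \<le> 2" if "c \<in> cylinder K" for c
    using norm_triangle_ineq[of "coord_proj K c" "c - coord_proj K c"] that
    by (auto simp: cylinder_def)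
  hence "cylinder K \<subseteq> cball 0 2" by auto
  thus ?thesis
    by (intro emeasure_bounded_finite bounded_subset[OF bounded_cball])
qed

lemma cylinder_partial_affine:
  assumes "coord_proj K t = t" "norm t + \<bar>a\<bar> \<le> 1" "c \<in> cylinder K"
  shows "t + a *\<^sub>R coord_proj K c + (c - coord_proj K c) \<in> cylinder K"
proof -
  have "norm (t + a *\<^sub>R coord_proj K c) \<le> norm t + \<bar>a\<bar> * norm (coord_proj K c)"
    using norm_triangle_ineq[of t "a *\<^sub>R coord_proj K c"] by simp
  also have "\<dots> \<le> norm t + \<bar>a\<bar> * 1"
    using assms(3) by (intro add_left_mono mult_left_mono) (auto simp: cylinder_def)
  finally have "norm (t + a *\<^sub>R coord_proj K c) \<le> 1"
    using assms(2) by simp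
  thus ?thesis
    using assms by (simp add: cylinder_def coord_proj_partial_affine del: add_diff_eq)
qed

text \<open>A supremum is bounded by an average. The maps \<open>c \<mapsto> (1 - \<epsilon>) c0 \<plusminus> \<epsilon> \<pi>\<^sub>K c\<close> send the cylinder into itself
  and shrink volumes by \<open>\<epsilon>\<^sup>k\<close>; averaging the two signs, the parallelogram law and the convexity of
  \<open>exp\<close> bound the mean of \<open>exp (\<mu> \<parallel>g\<parallel>\<^sup>2)\<close> over the two images below by its value at
  \<open>(1 - \<epsilon>) c0\<close>.\<close>

lemma exp_quadratic_le_cylinder_average:
  fixes g :: "real^'p \<Rightarrow> 'b::euclidean_space"
  assumes g: "linear g" and gK: "\<And>c. g c = g (coord_proj K c)"
    and c0: "coord_proj K c0 = c0" "norm c0 \<le> 1"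
    and \<epsilon>: "0 < \<epsilon>" "\<epsilon> \<le> 1" and \<mu>: "0 \<le> \<mu>"
  shows "ennreal (\<epsilon> ^ card K) * (ennreal (exp (\<mu> * (1 - \<epsilon>)\<^sup>2 * (norm (g c0))\<^sup>2))
      * emeasure lborel (cylinder K))
    \<le> (\<integral>\<^sup>+c\<in>cylinder K. ennreal (exp (\<mu> * (norm (g c))\<^sup>2)) \<partial>lborel)"
proof -
  define s where "s = 1 - \<epsilon>"
  define f where "f c = ennreal (exp (\<mu> * (norm (g c))\<^sup>2)) * indicator (cylinder K) c" for c
  define T where "T a c = s *\<^sub>R c0 + a *\<^sub>R coord_proj K c + (c - coord_proj K c)" for a c
  have g_meas[measurable]: "g \<in> borel_measurable borel"
    using g linear_continuous_on linear_linear borel_measurable_continuous_onI by blast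
  have f_meas[measurable]: "f \<in> borel_measurable borel"
    unfolding f_def by measurable
  have proj_meas[measurable]: "coord_proj K \<in> borel_measurable borel"
    by (intro borel_measurable_continuous_onI continuous_coord_proj)
  have T_meas[measurable]: "T a \<in> borel_measurable borel" for a
    unfolding T_def by measurable
  have change: "(\<integral>\<^sup>+c. f c \<partial>lborel) = ennreal (\<epsilon> ^ card K) * (\<integral>\<^sup>+c. f (T a c) \<partial>lborel)"
    if "\<bar>a\<bar> = \<epsilon>" for a
    using nn_integral_lborel_partial_affine[OF f_meas, of a K "s *\<^sub>R c0"] that \<epsilon>
    by (simp add: T_def)
  have T_in: "T a c \<in> cylinder K" if "\<bar>a\<bar> = \<epsilon>" "c \<in> cylinder K" for a c
    unfolding T_def
  proof (rule cylinder_partial_affine)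
    show "coord_proj K (s *\<^sub>R c0) = s *\<^sub>R c0"
      by (simp add: linear_scale[OF linear_coord_proj] c0)
    show "norm (s *\<^sub>R c0) + \<bar>a\<bar> \<le> 1"
      using mult_left_mono[OF c0(2), of s] \<epsilon> that by (simp add: s_def)
  qed fact
  have gT: "g (T a c) = s *\<^sub>R g c0 + a *\<^sub>R g c" for a c
  proof -
    have "coord_proj K (T a c) = s *\<^sub>R c0 + a *\<^sub>R coord_proj K c"
      unfolding T_def
      by (rule coord_proj_partial_affine) (simp add: linear_scale[OF linear_coord_proj] c0)
    thus ?thesis
      using gK[of "T a c"] gK[of c] by (simp add: linear_add[OF g] linear_scale[OF g])
  qed
  have pointwise: "2 * (ennreal (exp (\<mu> * s\<^sup>2 * (norm (g c0))\<^sup>2)) * indicator (cylinder K) c)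
      \<le> f (T \<epsilon> c) + f (T (-\<epsilon>) c)" for c
  proof (cases "c \<in> cylinder K")
    case True
    let ?x = "s *\<^sub>R g c0" and ?y = "\<epsilon> *\<^sub>R g c"
    let ?p = "\<mu> * (norm (?x + ?y))\<^sup>2" and ?m = "\<mu> * (norm (?x - ?y))\<^sup>2"
    have "?p + ?m = 2 * (\<mu> * (norm ?x)\<^sup>2) + 2 * (\<mu> * (norm ?y)\<^sup>2)"
      by (simp only: power2_norm_eq_inner) (simp add: algebra_simps inner_commute)
    hence "\<mu> * (norm ?x)\<^sup>2 \<le> (?p + ?m) / 2"
      using \<mu> by simp
    hence "exp (\<mu> * (norm ?x)\<^sup>2) \<le> exp (?p / 2) * exp (?m / 2)"
      by (simp add: exp_add[symmetric] add_divide_distrib)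
    moreover have "2 * (exp (?p / 2) * exp (?m / 2)) \<le> exp ?p + exp ?m"
      using sum_squares_bound[of "exp (?p / 2)" "exp (?m / 2)"]
      by (simp only: exp_double[symmetric]) simp
    ultimately have "2 * exp (\<mu> * s\<^sup>2 * (norm (g c0))\<^sup>2) \<le> exp ?p + exp ?m"
      by (simp add: power_mult_distrib mult.assoc)
    hence "ennreal (2 * exp (\<mu> * s\<^sup>2 * (norm (g c0))\<^sup>2)) \<le> ennreal (exp ?p + exp ?m)"
      by (rule ennreal_leI)
    thus ?thesis
      using True T_in[of \<epsilon> c] T_in[of "-\<epsilon>" c] \<epsilon>
      by (simp add: f_def gT ennreal_mult)
  qed simp
  have "2 * (ennreal (\<epsilon> ^ card K) * (ennreal (exp (\<mu> * s\<^sup>2 * (norm (g c0))\<^sup>2)) * emeasure lborel (cylinder K)))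
      = ennreal (\<epsilon> ^ card K) * (\<integral>\<^sup>+c. 2 * (ennreal (exp (\<mu> * s\<^sup>2 * (norm (g c0))\<^sup>2)) * indicator (cylinder K) c) \<partial>lborel)"
    by (simp add: nn_integral_cmult nn_integral_cmult_indicator mult.left_commute)
  also have "\<dots> \<le> ennreal (\<epsilon> ^ card K) * (\<integral>\<^sup>+c. f (T \<epsilon> c) + f (T (-\<epsilon>) c) \<partial>lborel)"
    by (intro mult_left_mono nn_integral_mono pointwise) auto
  also have "\<dots> = ennreal (\<epsilon> ^ card K) * (\<integral>\<^sup>+c. f (T \<epsilon> c) \<partial>lborel)
      + ennreal (\<epsilon> ^ card K) * (\<integral>\<^sup>+c. f (T (-\<epsilon>) c) \<partial>lborel)"
    by (subst nn_integral_add) (auto simp: distrib_left)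
  also have "\<dots> = 2 * (\<integral>\<^sup>+c. f c \<partial>lborel)"
    using change[of \<epsilon>] change[of "-\<epsilon>"] \<epsilon> by (simp add: mult_2)
  finally show ?thesis
    by (simp add: f_def s_def ennreal_mult_le_mult_iff)
qed

section \<open>Orthonormal expansions and column spans\<close>

lemma orthonormal_Parseval:
  fixes W :: "'a::euclidean_space set"
  assumes W: "finite W" "pairwise orthogonal W" "\<And>w. w \<in> W \<Longrightarrow> norm w = 1" and x: "x \<in> span W"
  shows "y \<bullet> x = (\<Sum>w\<in>W. (y \<bullet> w) * (x \<bullet> w))"
proof -
  have "y \<bullet> x = y \<bullet> (\<Sum>w\<in>W. (x \<bullet> w) *\<^sub>R w)"
    using orthonormal_basis_expand[OF W(2,3) x W(1)] by simp
  thus ?thesis by (simp add: inner_sum_right mult.commute)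
qed

lemma vector_matrix_mult_component: "(w v* E) $ j = column j E \<bullet> w"
  for E :: "real^'n^'m"
  by (simp add: vector_matrix_mult_def inner_vec_def column_def mult.commute)

lemma matrix_inner_columns: "E \<bullet> D = (\<Sum>j\<in>UNIV. column j E \<bullet> column j D)"
  for E D :: "real^'n^'m"
  unfolding inner_vec_def column_def by (subst sum.swap) simp

lemma matrix_Parseval:
  fixes E D :: "real^'n^'m"
  assumes W: "finite W" "pairwise orthogonal W" "\<And>w. w \<in> W \<Longrightarrow> norm w = 1"
    and D: "\<And>j. column j D \<in> span W"
  shows "E \<bullet> D = (\<Sum>w\<in>W. (w v* E) \<bullet> (w v* D))"
proof -
  have "E \<bullet> D = (\<Sum>j\<in>UNIV. \<Sum>w\<in>W. (column j E \<bullet> w) * (column j D \<bullet> w))"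
    unfolding matrix_inner_columns by (intro sum.cong refl orthonormal_Parseval W D)
  also have "\<dots> = (\<Sum>w\<in>W. (w v* E) \<bullet> (w v* D))"
    by (subst sum.swap) (simp add: inner_vec_def vector_matrix_mult_component)
  finally show ?thesis .
qed

lemma matrix_inner_le:
  fixes E D :: "real^'n^'m"
  assumes W: "finite W" "pairwise orthogonal W" "\<And>w. w \<in> W \<Longrightarrow> norm w = 1"
    and D: "\<And>j. column j D \<in> span W" and e: "e > 0"
  shows "2 * (E \<bullet> D) \<le> e * (norm D)\<^sup>2 + (\<Sum>w\<in>W. (norm (w v* E))\<^sup>2) / e"
proof -
  have "2 * (E \<bullet> D) = (\<Sum>w\<in>W. 2 * ((w v* E) \<bullet> (w v* D)))"
    by (simp add: matrix_Parseval[OF W D] sum_distrib_left)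
  also have "\<dots> \<le> (\<Sum>w\<in>W. e * (norm (w v* D))\<^sup>2 + (norm (w v* E))\<^sup>2 / e)"
  proof (rule sum_mono)
    fix w
    let ?x = "w v* E" and ?y = "w v* D"
    have "0 \<le> (norm (?x - e *\<^sub>R ?y))\<^sup>2 / e" using e by simp
    also have "\<dots> = (norm ?x)\<^sup>2 / e - 2 * (?x \<bullet> ?y) + e * (norm ?y)\<^sup>2"
      using e unfolding power2_norm_eq_inner
      by (simp add: inner_diff_left inner_diff_right inner_commute field_simps)
    finally show "2 * (?x \<bullet> ?y) \<le> e * (norm ?y)\<^sup>2 + (norm ?x)\<^sup>2 / e" by simp
  qed
  also have "\<dots> = e * (norm D)\<^sup>2 + (\<Sum>w\<in>W. (norm (w v* E))\<^sup>2) / e"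
    using matrix_Parseval[OF W D, of D]
    by (simp add: sum.distrib sum_distrib_left sum_divide_distrib power2_norm_eq_inner)
  finally show ?thesis .
qed

text \<open>An orthonormal basis of \<open>U + V\<close> that extends one of \<open>U\<close>; the part outside \<open>U\<close> has at most \<open>dim V\<close>
  elements, although its elements need not lie in \<open>V\<close>.\<close>

lemma nested_orthonormal_basis:
  fixes U :: "'a::euclidean_space set"
  assumes U: "subspace U" and V: "subspace V"
  obtains W1 W2 where "finite (W1 \<union> W2)" "W1 \<inter> W2 = {}" "pairwise orthogonal (W1 \<union> W2)"
    "\<And>w. w \<in> W1 \<union> W2 \<Longrightarrow> norm w = 1" "W1 \<subseteq> U" "W2 \<subseteq> {x + y |x y. x \<in> U \<and> y \<in> V}"
    "card W1 \<le> dim U" "card W2 \<le> dim V" "{x + y |x y. x \<in> U \<and> y \<in> V} \<subseteq> span (W1 \<union> W2)"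
proof -
  define S where "S = {x + y |x y. x \<in> U \<and> y \<in> V}"
  define C where "C = {y \<in> S. \<forall>x\<in>U. orthogonal x y}"
  have S: "subspace S" unfolding S_def by (rule subspace_sums[OF U V])
  have US: "U \<subseteq> S"
  proof
    fix x assume "x \<in> U"
    moreover have "x = x + 0" by simp
    ultimately show "x \<in> S" unfolding S_def using subspace_0[OF V] by blast
  qed
  have C: "subspace C"
    unfolding C_def using subspace_inter[OF S subspace_orthogonal_to_vectors[of U]] by (simp add: Int_def)
  obtain W1 where W1: "W1 \<subseteq> U" "pairwise orthogonal W1" "\<And>x. x \<in> W1 \<Longrightarrow> norm x = 1"
    "independent W1" "card W1 = dim U" "span W1 = U"
    using orthonormal_basis_subspace[OF U] by metis
  obtain W2 where W2: "W2 \<subseteq> C" "pairwise orthogonal W2" "\<And>x. x \<in> W2 \<Longrightarrow> norm x = 1"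
    "independent W2" "card W2 = dim C" "span W2 = C"
    using orthonormal_basis_subspace[OF C] by metis
  have fin: "finite W1" "finite W2"
    using W1(4) W2(4) independent_imp_finite by auto
  have cross: "orthogonal x y" if "x \<in> W1" "y \<in> W2" for x y
    using that W1(1) W2(1) by (auto simp: C_def)
  have "dim C + dim U = dim S"
    unfolding C_def by (rule dim_subspace_orthogonal_to_vectors[OF U S US])
  moreover have "dim S \<le> dim U + dim V"
    unfolding S_def using dim_sums_Int[OF U V] by linarith
  ultimately have card2: "card W2 \<le> dim V"
    using W2(5) by linarith
  have "S \<subseteq> span (W1 \<union> W2)"
  proof
    fix v assume v: "v \<in> S"
    obtain y z where yz: "y \<in> span U" "\<And>w. w \<in> span U \<Longrightarrow> orthogonal z w" "v = y + z"
      using orthogonal_subspace_decomp_exists[of U v] by metis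
    have yU: "y \<in> U" using yz(1) U by (metis span_eq_iff)
    have "z = v - y" using yz(3) by simp
    hence "z \<in> S" using subspace_diff[OF S v] yU US by blast
    hence "z \<in> C" using yz(2) span_superset[of U] by (auto simp: C_def orthogonal_commute)
    hence "z \<in> span W2" "y \<in> span W1" using W1(6) W2(6) yU by auto
    hence "z \<in> span (W1 \<union> W2)" "y \<in> span (W1 \<union> W2)"
      using span_mono[of W1 "W1 \<union> W2"] span_mono[of W2 "W1 \<union> W2"] by auto
    thus "v \<in> span (W1 \<union> W2)"
      using yz(3) span_add by blast
  qed
  moreover have "pairwise orthogonal (W1 \<union> W2)"
    using W1(2) W2(2) cross cross[THEN orthogonal_commute[THEN iffD1]] by (auto simp: pairwise_def)
  moreover have "W1 \<inter> W2 = {}"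
  proof -
    have "False" if "w \<in> W1" "w \<in> W2" for w
      using cross[OF that] W1(3)[OF that(1)] by (auto simp: orthogonal_self)
    thus ?thesis by blast
  qed
  moreover have "W2 \<subseteq> S" using W2(1) by (auto simp: C_def)
  ultimately show thesis
    using fin W1(1,3,5) W2(3) card2 by (intro that[of W1 W2]) (auto simp: S_def)
qed

text \<open>The span \<open>V\<^sub>K\<close> of the columns of \<open>X\<close> with index in \<open>K\<close>.\<close>

definition column_span :: "real^'p^'m \<Rightarrow> 'p set \<Rightarrow> (real^'m) set" where
  "column_span X K = span ((\<lambda>i. column i X) ` K)"

lemma column_span_mono: "K \<subseteq> L \<Longrightarrow> column_span X K \<subseteq> column_span X L"
  unfolding column_span_def by (intro span_mono image_mono)

lemma dim_column_span_le: "dim (column_span X K) \<le> card K"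
  unfolding column_span_def dim_span
  by (intro order_trans[OF dim_le_card' card_image_le]) auto

lemma range_mult_subset_column_span:
  fixes X :: "real^'p^'m" and C :: "real^'n^'p"
  shows "(X ** C) *v v \<in> column_span X (nonzero_rows C)"
proof -
  have zero: "(C *v v) $ i = 0" if "i \<notin> nonzero_rows C" for i
    using that by (simp add: nonzero_rows_def row_def matrix_vector_mult_def vec_eq_iff)
  have "(X ** C) *v v = X *v (C *v v)"
    by (simp add: matrix_vector_mul_assoc)
  also have "\<dots> = (\<Sum>i\<in>UNIV. (C *v v) $ i *s column i X)"
    by (rule matrix_mult_sum)
  also have "\<dots> = (\<Sum>i\<in>nonzero_rows C. (C *v v) $ i *\<^sub>R column i X)"
    using zero by (intro sum.mono_neutral_cong_right) (auto simp: scalar_mult_eq_scaleR)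
  also have "\<dots> \<in> column_span X (nonzero_rows C)"
    unfolding column_span_def by (intro span_sum span_scale span_base) auto
  finally show ?thesis .
qed

lemma column_eq_mult_axis: "column j D = D *v axis j 1"
  for D :: "real^'n^'m"
  by (simp add: matrix_vector_mult_basis)

text \<open>The matrix \<open>D\<close> of rank at most \<open>r1 + r2\<close> is expanded in an orthonormal basis whose first part, of size at most
  \<open>r1 = rank C1\<close>, spans the range of \<open>X C1\<close> and whose second part has size at most \<open>r2 = rank C2\<close>. Only
  the second part involves the joint support of \<open>C1\<close> and \<open>C2\<close>. The bound is used with
  \<open>r2 \<le> r1\<close>, so that the joint support is paired with the smaller rank.\<close>

lemma inner_matrix_difference_le:
  fixes E :: "real^'n^'m" and X :: "real^'p^'m" and C1 C2 :: "real^'n^'p" and D :: "real^'n^'m"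
  assumes D: "D = X ** C1 - X ** C2 \<or> D = X ** C2 - X ** C1"
    and e: "e > 0"
    and t1: "\<And>w. w \<in> column_span X (nonzero_rows C1) \<Longrightarrow> norm w = 1 \<Longrightarrow> (norm (w v* E))\<^sup>2 \<le> t1"
    and t2: "\<And>w. w \<in> column_span X (nonzero_rows C1 \<union> nonzero_rows C2) \<Longrightarrow> norm w = 1
      \<Longrightarrow> (norm (w v* E))\<^sup>2 \<le> t2"
    and t_nonneg: "0 \<le> t1" "0 \<le> t2"
  shows "2 * (E \<bullet> D) \<le> e * (norm D)\<^sup>2 + (real (rank C1) * t1 + real (rank C2) * t2) / e"
proof -
  let ?J1 = "nonzero_rows C1" and ?J2 = "nonzero_rows C2"
  define U where "U C = range ((*v) (X ** C))" for C :: "real^'n^'p"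
  have U: "subspace (U C)" for C
    unfolding U_def by (intro linear_subspace_image subspace_UNIV matrix_vector_mul_linear)
  have dimU: "dim (U C) \<le> rank C" for C
    using rank_mul_le_right[of X C] by (simp add: U_def rank_dim_range[symmetric])
  have UJ: "U C \<subseteq> column_span X (nonzero_rows C)" for C
    using range_mult_subset_column_span by (auto simp: U_def)
  obtain W1 W2 where W: "finite (W1 \<union> W2)" "W1 \<inter> W2 = {}" "pairwise orthogonal (W1 \<union> W2)"
    "\<And>w. w \<in> W1 \<union> W2 \<Longrightarrow> norm w = 1" "W1 \<subseteq> U C1"
    "W2 \<subseteq> {x + y |x y. x \<in> U C1 \<and> y \<in> U C2}"
    "card W1 \<le> dim (U C1)" "card W2 \<le> dim (U C2)"
    "{x + y |x y. x \<in> U C1 \<and> y \<in> U C2} \<subseteq> span (W1 \<union> W2)"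
    using nested_orthonormal_basis[OF U U] by blast
  have "column j D \<in> {x + y |x y. x \<in> U C1 \<and> y \<in> U C2}" for j
  proof -
    have "(X ** C) *v axis j 1 \<in> U C" "- ((X ** C) *v axis j 1) \<in> U C" for C
      using subspace_neg[OF U] by (auto simp: U_def)
    moreover have "column j D = (X ** C1) *v axis j 1 + - ((X ** C2) *v axis j 1) \<or>
        column j D = - ((X ** C1) *v axis j 1) + (X ** C2) *v axis j 1"
      using D by (auto simp: column_eq_mult_axis matrix_vector_mult_diff_rdistrib)
    ultimately show ?thesis by blast
  qed
  hence "2 * (E \<bullet> D) \<le> e * (norm D)\<^sup>2 + (\<Sum>w\<in>W1 \<union> W2. (norm (w v* E))\<^sup>2) / e"
    by (intro matrix_inner_le W e) (use W(9) in auto)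
  also have "(\<Sum>w\<in>W1 \<union> W2. (norm (w v* E))\<^sup>2) \<le> rank C1 * t1 + rank C2 * t2"
  proof -
    have "(\<Sum>w\<in>W1. (norm (w v* E))\<^sup>2) \<le> of_nat (card W1) * t1"
      using W UJ[of C1] by (intro sum_bounded_above t1) auto
    also have "\<dots> \<le> rank C1 * t1"
      using W(7) dimU[of C1] t_nonneg by (intro mult_right_mono) auto
    finally have 1: "(\<Sum>w\<in>W1. (norm (w v* E))\<^sup>2) \<le> rank C1 * t1" .
    have sub: "{x + y |x y. x \<in> U C1 \<and> y \<in> U C2} \<subseteq> column_span X (?J1 \<union> ?J2)"
      using UJ[of C1] UJ[of C2] column_span_mono[of ?J1 "?J1 \<union> ?J2" X]
        column_span_mono[of ?J2 "?J1 \<union> ?J2" X]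
      by (auto simp: column_span_def intro!: span_add)
    have "(\<Sum>w\<in>W2. (norm (w v* E))\<^sup>2) \<le> of_nat (card W2) * t2"
      using W sub by (intro sum_bounded_above t2) auto
    also have "\<dots> \<le> rank C2 * t2"
      using W(8) dimU[of C2] t_nonneg by (intro mult_right_mono) auto
    finally have 2: "(\<Sum>w\<in>W2. (norm (w v* E))\<^sup>2) \<le> rank C2 * t2" .
    show ?thesis
      using 1 2 W by (subst sum.union_disjoint) auto
  qed
  finally show ?thesis
    using e by (simp add: divide_right_mono)
qed

text \<open>A contraction that depends on the coordinates in \<open>K\<close> only and maps their unit ball onto the unit
  ball of \<open>V\<^sub>K\<close>. It sends coordinate vectors to an orthonormal basis, with some sent to zero when the
  columns are dependent.\<close>

lemma column_span_parametrization:
  fixes X :: "real^'p^'m"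
  obtains h :: "real^'p \<Rightarrow> real^'m" where "linear h" "\<And>c. h c = h (coord_proj K c)"
    "\<And>c. norm (h c) \<le> norm (coord_proj K c)"
    "\<And>z. z \<in> column_span X K \<Longrightarrow> \<exists>c. coord_proj K c = c \<and> norm c \<le> norm z \<and> h c = z"
proof -
  have V: "subspace (column_span X K)" by (simp add: column_span_def)
  obtain W where W: "W \<subseteq> column_span X K" "pairwise orthogonal W" "\<And>x. x \<in> W \<Longrightarrow> norm x = 1"
    "independent W" "card W = dim (column_span X K)" "span W = column_span X K"
    using orthonormal_basis_subspace[OF V] by metis
  have fin: "finite W" using W(4) independent_imp_finite by auto
  obtain \<phi> where \<phi>: "\<phi> ` W \<subseteq> K" "inj_on \<phi> W"
    using card_le_inj[OF fin, of K] W(5) dim_column_span_le[of X K] by auto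
  define h where "h c = (\<Sum>w\<in>W. (c $ \<phi> w) *\<^sub>R w)" for c :: "real^'p"
  have lin: "linear h"
    unfolding h_def by (rule linearI) (simp_all add: algebra_simps sum.distrib scaleR_sum_right)
  have norm_h: "(norm (h c))\<^sup>2 = (\<Sum>i\<in>\<phi> ` W. (c $ i)\<^sup>2)" for c
  proof -
    have "(norm (h c))\<^sup>2 = (\<Sum>w\<in>W. (norm ((c $ \<phi> w) *\<^sub>R w))\<^sup>2)"
      unfolding h_def using W(2)
      by (intro norm_sum_Pythagorean fin) (auto simp: pairwise_def orthogonal_clauses)
    also have "\<dots> = (\<Sum>w\<in>W. (c $ \<phi> w)\<^sup>2)"
      using W(3) by (intro sum.cong) (auto simp: power_mult_distrib)
    finally show ?thesis by (simp add: sum.reindex[OF \<phi>(2)])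
  qed
  have norm_sq: "(norm c)\<^sup>2 = (\<Sum>i\<in>UNIV. (c $ i)\<^sup>2)" for c :: "real^'p"
    by (simp add: norm_vec_def L2_set_def sum_nonneg)
  show thesis
  proof (rule that[of h])
    show "h c = h (coord_proj K c)" for c
      using \<phi>(1) by (auto simp: h_def coord_proj_def intro!: sum.cong)
    show "norm (h c) \<le> norm (coord_proj K c)" for c
    proof (rule power2_le_imp_le)
      have "(norm (h c))\<^sup>2 = (\<Sum>i\<in>\<phi> ` W. (coord_proj K c $ i)\<^sup>2)"
        using \<phi>(1) unfolding norm_h by (auto simp: coord_proj_def intro!: sum.cong)
      also have "\<dots> \<le> (norm (coord_proj K c))\<^sup>2"
        unfolding norm_sq by (intro sum_mono2) auto
      finally show "(norm (h c))\<^sup>2 \<le> (norm (coord_proj K c))\<^sup>2" .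
    qed simp
    show "\<exists>c. coord_proj K c = c \<and> norm c \<le> norm z \<and> h c = z" if z: "z \<in> column_span X K" for z
    proof -
      define c where "c = (\<chi> i. if i \<in> \<phi> ` W then z \<bullet> inv_into W \<phi> i else 0)"
      have hc: "h c = z"
      proof -
        have "h c = (\<Sum>w\<in>W. (z \<bullet> w) *\<^sub>R w)"
          unfolding h_def c_def using \<phi>(2) by (intro sum.cong) auto
        thus ?thesis
          using orthonormal_basis_expand[OF W(2,3) _ fin, of z] z W(6) by simp
      qed
      have "(norm c)\<^sup>2 = (\<Sum>i\<in>\<phi> ` W. (c $ i)\<^sup>2)"
        unfolding norm_sq by (intro sum.mono_neutral_right) (auto simp: c_def)
      hence "(norm c)\<^sup>2 = (norm z)\<^sup>2" using norm_h[of c] hc by simp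
      hence "norm c \<le> norm z" by simp
      moreover have "coord_proj K c = c"
        using \<phi>(1) by (auto simp: coord_proj_def c_def vec_eq_iff)
      ultimately show ?thesis using hc by blast
    qed
  qed (fact lin)
qed

section \<open>Thresholds and the deterministic oracle inequality\<close>

text \<open>The function \<open>x log (e p / x)\<close>, an upper bound for the logarithm of the number of \<open>x\<close>-element subsets of
  a \<open>p\<close>-element set. Its value at \<open>0\<close> is \<open>0\<close>.\<close>

definition entropy_bound :: "real \<Rightarrow> real \<Rightarrow> real" where
  "entropy_bound p x = x * ln (exp 1 * p / x)"

lemma entropy_bound_0 [simp]: "entropy_bound p 0 = 0"
  by (simp add: entropy_bound_def)

lemma entropy_bound_nonneg: "0 \<le> x \<Longrightarrow> x \<le> p \<Longrightarrow> 0 \<le> entropy_bound p x"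
proof (cases "x = 0")
  case False
  assume x: "0 \<le> x" "x \<le> p"
  have "1 * x \<le> exp 1 * p" using x by (intro mult_mono) auto
  thus ?thesis using False x by (auto simp: entropy_bound_def intro!: mult_nonneg_nonneg ln_ge_zero)
qed simp

lemma entropy_bound_mono:
  assumes "0 \<le> x" "x \<le> y" "y \<le> p"
  shows "entropy_bound p x \<le> entropy_bound p y"
proof (cases "x = 0")
  case True
  thus ?thesis using entropy_bound_nonneg[of y p] assms by simp
next
  case False
  hence pos: "x > 0" "y > 0" "p > 0" using assms by auto
  have split: "ln (exp 1 * p / u) = 1 + ln (p / u)" if "u > 0" for u
    using that pos by (simp add: ln_div ln_mult)
  have "ln (p / x) = ln (p / y) + ln (y / x)"
    using pos by (simp add: ln_div)
  also have "ln (y / x) \<le> y / x - 1"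
    using pos by (intro ln_le_minus_one) simp
  finally have "x * (1 + ln (p / x)) \<le> x * (ln (p / y) + y / x)"
    using pos by (intro mult_left_mono) auto
  also have "\<dots> = x * ln (p / y) + y" using pos by (simp add: field_simps)
  also have "x * ln (p / y) \<le> y * ln (p / y)"
    using assms pos by (intro mult_right_mono ln_ge_zero) auto
  finally show ?thesis
    unfolding entropy_bound_def split[OF pos(1)] split[OF pos(2)] by (simp add: distrib_left)
qed

lemma entropy_bound_subadditive:
  assumes "0 \<le> x" "0 \<le> y" "0 < p"
  shows "entropy_bound p (x + y) \<le> entropy_bound p x + entropy_bound p y"
proof -
  have "u * ln (exp 1 * p / (u + v)) \<le> entropy_bound p u" if "0 \<le> u" "0 \<le> v" for u v
  proof (cases "u = 0")
    case False
    hence "ln (exp 1 * p / (u + v)) \<le> ln (exp 1 * p / u)"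
      using that assms by (intro ln_mono divide_left_mono divide_pos_pos mult_pos_pos) auto
    thus ?thesis using that by (simp add: entropy_bound_def mult_left_mono)
  qed simp
  from this[of x y] this[of y x] show ?thesis
    using assms by (simp add: entropy_bound_def distrib_right add.commute)
qed

lemma binomial_le_exp_entropy_bound:
  assumes "0 < k" "k \<le> p"
  shows "real (p choose k) \<le> exp (entropy_bound (real p) (real k))"
proof -
  \<comment> \<open>Bound one term of the binomial expansion of \<open>(1 + x)\<^sup>p\<close>; this \<open>x\<close> minimizes \<open>exp (p x) / x\<^sup>k\<close>.\<close>
  define x where "x = real k / real p"
  have x: "x > 0" using assms by (simp add: x_def)
  have "real (p choose k) * x ^ k \<le> (\<Sum>i\<le>p. real (p choose i) * x ^ i * 1 ^ (p - i))"
    using assms x member_le_sum[of k "{..p}" "\<lambda>i. real (p choose i) * x ^ i"] by simp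
  also have "\<dots> = (x + 1) ^ p" by (rule binomial_ring[symmetric])
  also have "\<dots> \<le> exp x ^ p"
    using x exp_ge_add_one_self[of x] by (intro power_mono) (auto simp: add.commute)
  also have "\<dots> = exp 1 ^ k"
    using assms by (simp add: exp_of_nat_mult[symmetric] x_def)
  finally have "real (p choose k) \<le> (exp 1 / x) ^ k"
    using x by (simp add: power_divide field_simps)
  also have "exp 1 / x = exp (ln (exp 1 * real p / real k))"
    using assms by (simp add: x_def)
  finally show ?thesis
    by (simp add: entropy_bound_def exp_of_nat_mult[symmetric])
qed

lemma sum_powers_le:
  fixes q :: real
  assumes "0 \<le> q" "q < 1"
  shows "(\<Sum>k=1..n. q ^ k) \<le> q / (1 - q)"
proof -
  have "(\<Sum>k=1..n. q ^ k) * (1 - q) = q - q ^ Suc n"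
  proof (induction n)
    case (Suc n)
    have "(\<Sum>k=1..Suc n. q ^ k) = (\<Sum>k=1..n. q ^ k) + q ^ Suc n" by simp
    thus ?case using Suc.IH by (simp only: distrib_right) (simp add: right_diff_distrib)
  qed simp
  also have "\<dots> \<le> q" using assms by simp
  finally show ?thesis using assms by (simp add: pos_le_divide_eq)
qed

lemma sum_subsets_entropy_weight_le:
  assumes q: "0 \<le> q" "q < 1"
  shows "(\<Sum>K\<in>UNIV - {{} :: 'p::finite set}. q ^ card K * exp (- entropy_bound (real CARD('p)) (real (card K))))
    \<le> q / (1 - q)"
proof -
  let ?p = "CARD('p)"
  let ?w = "\<lambda>k. q ^ k * exp (- entropy_bound (real ?p) (real k))"
  have le: "card K \<le> ?p" for K :: "'p set" by (intro card_mono) auto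
  have "(\<Sum>K\<in>UNIV - {{} :: 'p set}. ?w (card K))
      = (\<Sum>k=1..?p. \<Sum>K | K \<in> UNIV - {{} :: 'p set} \<and> card K = k. ?w (card K))"
    by (rule sum.group[symmetric]) (auto simp: le Suc_le_eq card_gt_0_iff)
  also have "\<dots> \<le> (\<Sum>k=1..?p. q ^ k)"
  proof (rule sum_mono)
    fix k assume k: "k \<in> {1..?p}"
    have "{K. K \<in> UNIV - {{} :: 'p set} \<and> card K = k} = {K. K \<subseteq> UNIV \<and> card K = k}"
      using k by auto
    hence "(\<Sum>K | K \<in> UNIV - {{} :: 'p set} \<and> card K = k. ?w (card K)) = real (?p choose k) * ?w k"
      by (simp add: n_subsets del: top_greatest)
    also have "\<dots> \<le> exp (entropy_bound (real ?p) (real k)) * ?w k"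
      using k q by (intro mult_right_mono binomial_le_exp_entropy_bound) auto
    also have "\<dots> = q ^ k" by (simp add: exp_minus)
    finally show "(\<Sum>K | K \<in> UNIV - {{} :: 'p set} \<and> card K = k. ?w (card K)) \<le> q ^ k" .
  qed
  also have "\<dots> \<le> q / (1 - q)" by (rule sum_powers_le[OF q])
  finally show ?thesis .
qed

text \<open>The part of the penalty per unit of rank, up to the factor \<open>c \<sigma>\<^sup>2\<close>, that depends on the set \<open>K\<close> of
  nonzero rows.\<close>

definition pen_rate :: "'p::finite set \<Rightarrow> real" where
  "pen_rate K = ln (2 * exp 1) * real (card K) + entropy_bound (real CARD('p)) (real (card K))"

lemma pen_eq_rate:
  fixes B :: "real^'n^'p"
  shows "pen c \<sigma> B = c * \<sigma>\<^sup>2 * real (rank B) * (2 * real CARD('n) + pen_rate (nonzero_rows B))"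
  by (simp add: pen_def pen_rate_def entropy_bound_def)

lemma pen_rate_nonneg: "0 \<le> pen_rate K"
  and pen_rate_subadditive: "pen_rate (K \<union> L) \<le> pen_rate K + pen_rate L"
  for K L :: "'p::finite set"
proof -
  have le: "real (card K) \<le> real CARD('p)" for K :: "'p set" by (simp add: card_mono)
  have l: "0 \<le> ln (2 * exp (1::real))"
    using one_le_exp_iff[of "1::real"] by (intro ln_ge_zero) linarith
  show "0 \<le> pen_rate K"
    using l le by (simp add: pen_rate_def entropy_bound_nonneg)
  have "card (K \<union> L) = card K + card (L - K)"
    by (subst card_Un_disjoint[symmetric]) auto
  moreover have "entropy_bound (real CARD('p)) (real (card (L - K)))
      \<le> entropy_bound (real CARD('p)) (real (card L))"
    by (intro entropy_bound_mono le) (auto intro: card_mono)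
  moreover have "entropy_bound (real CARD('p)) (real (card K) + real (card (L - K)))
      \<le> entropy_bound (real CARD('p)) (real (card K)) + entropy_bound (real CARD('p)) (real (card (L - K)))"
    by (intro entropy_bound_subadditive) auto
  moreover have "ln (2 * exp (1::real)) * real (card (K \<union> L)) \<le> ln (2 * exp 1) * (real (card K) + real (card L))"
    using l card_Un_le[of K L] by (intro mult_left_mono) linarith+
  ultimately show "pen_rate (K \<union> L) \<le> pen_rate K + pen_rate L"
    by (simp add: pen_rate_def distrib_left)
qed

lemma exp_1_ge: "8 / 3 \<le> exp (1::real)"
proof -
  have "(\<Sum>k<4. 1 / fact k) \<le> exp (1::real)"
    using sum_le_suminf[of "\<lambda>k. inverse (fact k) *\<^sub>R (1::real) ^ k" "{..<4}"] summable_exp_generic[of "1::real"]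
    by (simp add: exp_def inverse_eq_divide)
  thus ?thesis by (simp add: eval_nat_numeral)
qed

text \<open>The level above which \<open>\<parallel>w v* E\<parallel>\<^sup>2\<close> is exceptionally large for a unit vector \<open>w\<close> of \<open>V\<^sub>K\<close>. The factor
  \<open>81/26\<close> is \<open>12 (27/52) / 2\<close>, which makes the sum of the thresholds over an orthonormal basis at most the
  penalties times \<open>27/52\<close>.\<close>

definition noise_threshold :: "real \<Rightarrow> nat \<Rightarrow> 'p::finite set \<Rightarrow> real" where
  "noise_threshold \<sigma> n K = 81/26 * \<sigma>\<^sup>2 * (4 * real n + pen_rate K)"

lemma noise_threshold_nonneg: "0 \<le> noise_threshold \<sigma> n K"
  by (simp add: noise_threshold_def pen_rate_nonneg)

lemma rank_threshold_le_pen: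
  fixes C1 C2 :: "real^'n^'p"
  assumes "rank C2 \<le> rank C1"
  shows "real (rank C1) * noise_threshold \<sigma> CARD('n) (nonzero_rows C1)
      + real (rank C2) * noise_threshold \<sigma> CARD('n) (nonzero_rows C1 \<union> nonzero_rows C2)
    \<le> 27/52 * (pen 12 \<sigma> C1 + pen 12 \<sigma> C2)"
proof -
  let ?r1 = "real (rank C1)" and ?r2 = "real (rank C2)" and ?n = "real CARD('n)"
  let ?a1 = "pen_rate (nonzero_rows C1)" and ?a2 = "pen_rate (nonzero_rows C2)"
  have "?r2 * pen_rate (nonzero_rows C1 \<union> nonzero_rows C2) \<le> ?r2 * (?a1 + ?a2)"
    by (intro mult_left_mono pen_rate_subadditive) auto
  moreover have "?r2 * ?a1 \<le> ?r1 * ?a1"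
    using assms by (intro mult_right_mono pen_rate_nonneg) auto
  moreover have "0 \<le> ?r2 * ?a2" by (simp add: pen_rate_nonneg)
  ultimately have "?r1 * (4 * ?n + ?a1) + ?r2 * (4 * ?n + pen_rate (nonzero_rows C1 \<union> nonzero_rows C2))
      \<le> 2 * (?r1 * (2 * ?n + ?a1) + ?r2 * (2 * ?n + ?a2))"
    by (simp add: algebra_simps)
  hence "81/26 * \<sigma>\<^sup>2 * (?r1 * (4 * ?n + ?a1) + ?r2 * (4 * ?n + pen_rate (nonzero_rows C1 \<union> nonzero_rows C2)))
      \<le> 81/26 * \<sigma>\<^sup>2 * (2 * (?r1 * (2 * ?n + ?a1) + ?r2 * (2 * ?n + ?a2)))"
    by (intro mult_left_mono) auto
  also have "\<dots> = 27/52 * (pen 12 \<sigma> C1 + pen 12 \<sigma> C2)"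
    by (simp add: pen_eq_rate distrib_left)
  finally show ?thesis
    by (simp only: noise_threshold_def distrib_left mult.left_commute[of _ "81/26 * \<sigma>\<^sup>2"])
qed

text \<open>If the noise exceeds the thresholds by at most \<open>\<rho>\<close>, the noise term is absorbed by a
  fraction of the squared distance of \<open>X B\<close> and \<open>X C\<close>, the two penalties and a multiple of \<open>\<rho>\<close>. The roles of \<open>B\<close> and \<open>C\<close> are exchanged when \<open>B\<close> has the larger rank.\<close>

lemma inner_noise_le:
  fixes E :: "real^'n^'m" and X :: "real^'p^'m" and B C :: "real^'n^'p"
  assumes \<rho>: "0 \<le> \<rho>"
    and E: "\<And>K w. w \<in> column_span X K \<Longrightarrow> norm w = 1
      \<Longrightarrow> (norm (w v* E))\<^sup>2 \<le> noise_threshold \<sigma> CARD('n) K + \<rho>"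
  shows "2 * (E \<bullet> (X ** C - X ** B)) \<le> 27/52 * (norm (X ** C - X ** B))\<^sup>2
    + pen 12 \<sigma> B + pen 12 \<sigma> C + 104/27 * real CARD('n) * \<rho>"
proof -
  define D where "D = X ** C - X ** B"
  have main: "2 * (E \<bullet> D) \<le> 27/52 * (norm D)\<^sup>2 + pen 12 \<sigma> C1 + pen 12 \<sigma> C2 + 104/27 * real CARD('n) * \<rho>"
    if rank: "rank C2 \<le> rank C1" and D: "D = X ** C1 - X ** C2 \<or> D = X ** C2 - X ** C1" for C1 C2
  proof -
    let ?F = "noise_threshold \<sigma> CARD('n) :: 'p set \<Rightarrow> real"
    let ?r1 = "real (rank C1)" and ?r2 = "real (rank C2)" and ?K = "nonzero_rows C1 \<union> nonzero_rows C2"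
    have "2 * (E \<bullet> D) \<le> 27/52 * (norm D)\<^sup>2
        + (?r1 * (?F (nonzero_rows C1) + \<rho>) + ?r2 * (?F ?K + \<rho>)) / (27/52)"
      using \<rho> by (intro inner_matrix_difference_le[OF D _ E E] add_nonneg_nonneg noise_threshold_nonneg) auto
    moreover have "?r1 * (?F (nonzero_rows C1) + \<rho>) + ?r2 * (?F ?K + \<rho>)
        \<le> 27/52 * (pen 12 \<sigma> C1 + pen 12 \<sigma> C2) + 2 * real CARD('n) * \<rho>"
    proof -
      have "rank C1 \<le> CARD('n)" "rank C2 \<le> CARD('n)"
        using rank_bound[of C1] rank_bound[of C2] by auto
      hence "?r1 * \<rho> \<le> real CARD('n) * \<rho>" "?r2 * \<rho> \<le> real CARD('n) * \<rho>"
        using \<rho> by (auto intro: mult_right_mono)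
      thus ?thesis using rank_threshold_le_pen[OF rank, of \<sigma>] by (simp add: distrib_left)
    qed
    ultimately show ?thesis by (simp add: field_simps)
  qed
  show ?thesis
    using main[of B C] main[of C B] unfolding D_def by (cases "rank B \<le> rank C") auto
qed

text \<open>The deterministic oracle inequality. With \<open>\<parallel>X C - X B\<parallel>\<^sup>2 \<le> 4/3 \<parallel>X A - X C\<parallel>\<^sup>2 + 4 \<parallel>X A - X B\<parallel>\<^sup>2\<close> and weight
  \<open>27/52\<close>, the loss of \<open>C\<close> keeps the coefficient \<open>1 - 27/52 * 4/3 = 4/13\<close> and that of \<open>B\<close> becomes
  \<open>1 + 27/52 * 4 = 40/13\<close>, whose quotient is \<open>10\<close>. The coefficient of \<open>pen B\<close> becomes
  \<open>2 * 13/4 = 13/2\<close>, which is less than \<open>8\<close>.\<close>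

lemma penalized_minimizer_loss_le:
  fixes E :: "real^'n^'m" and X :: "real^'p^'m" and A B C :: "real^'n^'p"
  assumes min: "(norm (X ** A + E - X ** C))\<^sup>2 + pen 12 \<sigma> C \<le> (norm (X ** A + E - X ** B))\<^sup>2 + pen 12 \<sigma> B"
    and \<rho>: "0 \<le> \<rho>"
    and E: "\<And>K w. w \<in> column_span X K \<Longrightarrow> norm w = 1
      \<Longrightarrow> (norm (w v* E))\<^sup>2 \<le> noise_threshold \<sigma> CARD('n) K + \<rho>"
  shows "(norm (X ** A - X ** C))\<^sup>2
    \<le> 10 * (norm (X ** A - X ** B))\<^sup>2 + 8 * pen 12 \<sigma> B + 338/27 * real CARD('n) * \<rho>"
proof -
  let ?c = "X ** A - X ** C" and ?b = "X ** A - X ** B" and ?D = "X ** C - X ** B"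
  have expand: "(norm (X ** A + E - X ** G))\<^sup>2
      = (norm (X ** A - X ** G))\<^sup>2 + 2 * (E \<bullet> (X ** A - X ** G)) + (norm E)\<^sup>2" for G
    unfolding power2_norm_eq_inner by (simp add: algebra_simps inner_commute)
  have "E \<bullet> ?b - E \<bullet> ?c = E \<bullet> ?D"
    by (simp add: inner_diff_right)
  hence "(norm ?c)\<^sup>2 + pen 12 \<sigma> C \<le> (norm ?b)\<^sup>2 + 2 * (E \<bullet> ?D) + pen 12 \<sigma> B"
    using min unfolding expand by linarith
  moreover have "2 * (E \<bullet> ?D) \<le> 27/52 * (norm ?D)\<^sup>2
      + pen 12 \<sigma> B + pen 12 \<sigma> C + 104/27 * real CARD('n) * \<rho>"
    by (intro inner_noise_le \<rho> E)
  ultimately have 1: "(norm ?c)\<^sup>2 \<le> (norm ?b)\<^sup>2 + 27/52 * (norm ?D)\<^sup>2 + 2 * pen 12 \<sigma> B + 104/27 * real CARD('n) * \<rho>"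
    by linarith
  have "(norm ?D)\<^sup>2 \<le> 4/3 * (norm ?c)\<^sup>2 + 4 * (norm ?b)\<^sup>2"
  proof -
    have "0 \<le> (norm (?c + 3 *\<^sub>R ?b))\<^sup>2 / 3" by simp
    also have "\<dots> = 4/3 * (norm ?c)\<^sup>2 + 4 * (norm ?b)\<^sup>2 - (norm (?b - ?c))\<^sup>2"
      unfolding power2_norm_eq_inner
      by (simp only: inner_add_left inner_add_right inner_diff_left[of ?b ?c] inner_diff_right[of _ ?b ?c]
          inner_scaleR_left inner_scaleR_right inner_commute[of ?c ?b]) (simp add: field_simps)
    also have "?b - ?c = ?D" by simp
    finally show ?thesis by simp
  qed
  with 1 show ?thesis
    using pen_nonneg[of 12 \<sigma> B] by (simp add: field_simps)
qed

section \<open>Exponential moments of Gaussian noise\<close>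

lemma nn_integral_normal_exp_square:
  assumes "0 < \<tau>" and "2 * \<nu> * \<tau>\<^sup>2 < 1"
  shows "(\<integral>\<^sup>+x. ennreal (normal_density 0 \<tau> x) * ennreal (exp (\<nu> * x\<^sup>2)) \<partial>lborel)
    = ennreal (1 / sqrt (1 - 2 * \<nu> * \<tau>\<^sup>2))"
proof -
  define d where "d = 1 - 2 * \<nu> * \<tau>\<^sup>2"
  have d: "d > 0" using assms by (simp add: d_def)
  define \<rho> where "\<rho> = \<tau> / sqrt d"
  have \<rho>: "\<rho> > 0" using d assms by (simp add: \<rho>_def)
  have \<rho>2: "\<rho>\<^sup>2 = \<tau>\<^sup>2 / d"
    using d by (simp add: \<rho>_def power_divide)
  have eq: "normal_density 0 \<tau> x * exp (\<nu> * x\<^sup>2) = 1 / sqrt d * normal_density 0 \<rho> x" for x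
  proof -
    have "- x\<^sup>2 / (2 * \<tau>\<^sup>2) + \<nu> * x\<^sup>2 = - x\<^sup>2 / (2 * \<rho>\<^sup>2)"
      unfolding \<rho>2 using d assms by (simp add: d_def field_simps)
    hence "exp (- x\<^sup>2 / (2 * \<tau>\<^sup>2)) * exp (\<nu> * x\<^sup>2) = exp (- x\<^sup>2 / (2 * \<rho>\<^sup>2))"
      by (simp add: exp_add[symmetric])
    moreover have "1 / sqrt (2 * pi * \<tau>\<^sup>2) = 1 / sqrt d * (1 / sqrt (2 * pi * \<rho>\<^sup>2))"
      unfolding \<rho>2 using d assms by (simp add: real_sqrt_mult real_sqrt_divide field_simps)
    ultimately show ?thesis
      unfolding normal_density_def by (simp add: mult.assoc)
  qed
  have "(\<integral>\<^sup>+x. ennreal (normal_density 0 \<tau> x) * ennreal (exp (\<nu> * x\<^sup>2)) \<partial>lborel)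
      = (\<integral>\<^sup>+x. ennreal (1 / sqrt d) * ennreal (normal_density 0 \<rho> x) \<partial>lborel)"
    by (intro nn_integral_cong) (use d in \<open>simp add: ennreal_mult[symmetric] eq\<close>)
  also have "\<dots> = ennreal (1 / sqrt d) * (\<integral>\<^sup>+x. ennreal (normal_density 0 \<rho> x) \<partial>lborel)"
    by (rule nn_integral_cmult) auto
  also have "(\<integral>\<^sup>+x. ennreal (normal_density 0 \<rho> x) \<partial>lborel) = 1"
    using \<rho> by (subst nn_integral_eq_integral) auto
  finally show ?thesis by (simp add: d_def)
qed

text \<open>The choice of \<open>\<epsilon>\<close> is constrained on both sides: \<open>\<epsilon>\<close> must be so small that
  \<open>\<mu> = 26 / (81 (1 - \<epsilon>)\<^sup>2)\<close> stays below \<open>1/2\<close>, and \<open>1 / \<epsilon>\<close> must stay below \<open>2 e\<close>, so that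
  the sum over all index sets is bounded by a geometric series, here of ratio \<open>20/21\<close>. The bound
  \<open>exp (7/2)\<close> leaves \<open>exp (- 1/2)\<close> per column of the noise after division by \<open>exp 4\<close>.\<close>

lemma exp_moment_constants:
  fixes \<epsilon> \<mu> :: real
  defines "\<epsilon> \<equiv> 197/1000" and "\<mu> \<equiv> 26/81 / (1 - \<epsilon>)\<^sup>2"
  shows "2 * \<mu> < 1" "1 / sqrt (1 - 2 * \<mu>) \<le> exp (7/2)" "1 / \<epsilon> \<le> 20/21 * (2 * exp 1)"
proof -
  have d: "1 / 500 \<le> 1 - 2 * \<mu>" by (simp add: \<mu>_def \<epsilon>_def power2_eq_square)
  thus "2 * \<mu> < 1" by simp
  have "(500::real) \<le> (8/3) ^ 7" by (simp add: power_divide)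
  also have "\<dots> \<le> exp 1 ^ 7" by (intro power_mono exp_1_ge) auto
  also have "\<dots> = (exp (7/2))\<^sup>2" by (simp add: exp_of_nat_mult[symmetric] exp_double[symmetric])
  finally have "sqrt 500 \<le> exp (7/2)" by (intro real_le_lsqrt) auto
  moreover have "1 / sqrt (1 - 2 * \<mu>) \<le> sqrt 500"
  proof -
    have "1 / (1 - 2 * \<mu>) \<le> 500" using d by (simp add: field_simps)
    hence "sqrt (1 / (1 - 2 * \<mu>)) \<le> sqrt 500" by (rule real_sqrt_le_mono)
    thus ?thesis by (simp add: real_sqrt_divide)
  qed
  ultimately show "1 / sqrt (1 - 2 * \<mu>) \<le> exp (7/2)" by linarith
  show "1 / \<epsilon> \<le> 20/21 * (2 * exp 1)" using exp_1_ge by (simp add: \<epsilon>_def)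
qed

context prob_space
begin

context
  fixes E :: "'a \<Rightarrow> real^'n^'m" and \<sigma> :: real
  assumes \<sigma>: "\<sigma> > 0"
    and indep: "indep_vars (\<lambda>_. borel) (\<lambda>(i, j) \<omega>. E \<omega> $ i $ j) UNIV"
    and normal: "\<And>i j. distributed M lborel (\<lambda>\<omega>. E \<omega> $ i $ j) (normal_density 0 \<sigma>)"
begin

lemma entry_measurable [measurable]: "(\<lambda>\<omega>. E \<omega> $ i $ j) \<in> borel_measurable M"
  using distributed_measurable[OF normal, of i j] by simp

lemma distributed_entry_combination:
  assumes "z \<noteq> 0"
  shows "distributed M lborel (\<lambda>\<omega>. (z v* E \<omega>) $ j) (normal_density 0 (\<sigma> * norm z))"
proof -
  \<comment> \<open>The coordinates with \<open>z $ i = 0\<close> would contribute degenerate normal variables.\<close>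
  define S where "S = {i. z $ i \<noteq> 0}"
  have "S \<noteq> {}" using assms by (auto simp: S_def vec_eq_iff)
  have "indep_vars (\<lambda>i. PiM {(i, j)} (\<lambda>_. borel))
      (\<lambda>i \<omega>. restrict (\<lambda>k. (\<lambda>(i, j) \<omega>. E \<omega> $ i $ j) k \<omega>) {(i, j)}) S"
    by (rule indep_vars_restrict[OF indep]) (auto simp: disjoint_family_on_def)
  hence "indep_vars (\<lambda>_. borel) (\<lambda>i \<omega>. (\<lambda>x. z $ i * x (i, j))
      (restrict (\<lambda>k. (\<lambda>(i, j) \<omega>. E \<omega> $ i $ j) k \<omega>) {(i, j)})) S"
    by (rule indep_vars_compose2[where N = "\<lambda>_. borel"]) measurable
  hence ind: "indep_vars (\<lambda>_. borel) (\<lambda>i \<omega>. z $ i * E \<omega> $ i $ j) S"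
    by simp
  have "distributed M lborel (\<lambda>\<omega>. \<Sum>i\<in>S. z $ i * E \<omega> $ i $ j)
      (normal_density (\<Sum>i\<in>S. 0) (sqrt (\<Sum>i\<in>S. (\<bar>z $ i\<bar> * \<sigma>)\<^sup>2)))"
  proof (rule sum_indep_normal[OF _ \<open>S \<noteq> {}\<close> ind])
    fix i assume "i \<in> S"
    thus "distributed M lborel (\<lambda>\<omega>. z $ i * E \<omega> $ i $ j) (normal_density 0 (\<bar>z $ i\<bar> * \<sigma>))"
      using normal_density_affine[OF normal[of i j] \<sigma>, of "z $ i" 0] by (simp add: S_def)
  qed (use \<sigma> in \<open>auto simp: S_def\<close>)
  moreover have "(\<Sum>i\<in>S. z $ i * E \<omega> $ i $ j) = (z v* E \<omega>) $ j" for \<omega>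
    unfolding vector_matrix_mult_def S_def
    by (auto intro!: sum.mono_neutral_cong_left)
  moreover have "sqrt (\<Sum>i\<in>S. (\<bar>z $ i\<bar> * \<sigma>)\<^sup>2) = \<sigma> * norm z"
  proof -
    have "(\<Sum>i\<in>S. (\<bar>z $ i\<bar> * \<sigma>)\<^sup>2) = (\<Sum>i\<in>UNIV. \<sigma>\<^sup>2 * (z $ i)\<^sup>2)"
      unfolding S_def by (auto simp: power_mult_distrib intro!: sum.mono_neutral_cong_left)
    also have "\<dots> = \<sigma>\<^sup>2 * (norm z)\<^sup>2"
      by (simp add: sum_distrib_left[symmetric] norm_vec_def L2_set_def sum_nonneg)
    finally show ?thesis
      using \<sigma> by (simp add: real_sqrt_mult)
  qed
  ultimately show ?thesis by simp
qed

lemma indep_vars_column_combinations: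
  "indep_vars (\<lambda>_. borel) (\<lambda>j \<omega>. (z v* E \<omega>) $ j) UNIV"
proof -
  let ?K = "\<lambda>j::'n. UNIV \<times> {j} :: ('m \<times> 'n) set"
  have "indep_vars (\<lambda>j. PiM (?K j) (\<lambda>_. borel))
      (\<lambda>j \<omega>. restrict (\<lambda>i. (\<lambda>(i, j) \<omega>. E \<omega> $ i $ j) i \<omega>) (?K j)) UNIV"
    by (rule indep_vars_restrict[OF indep]) (auto simp: disjoint_family_on_def)
  hence "indep_vars (\<lambda>_. borel)
      (\<lambda>j \<omega>. (\<lambda>x. \<Sum>i\<in>UNIV. z $ i * x (i, j))
         (restrict (\<lambda>i. (\<lambda>(i, j) \<omega>. E \<omega> $ i $ j) i \<omega>) (?K j))) UNIV"
    by (rule indep_vars_compose2[where N = "\<lambda>_. borel"]) measurable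
  thus ?thesis
    by (simp add: vector_matrix_mult_def mult.commute)
qed

text \<open>For a unit vector \<open>z\<close> the variable \<open>\<parallel>z v* E\<parallel>\<^sup>2 / \<sigma>\<^sup>2\<close> has the chi-square distribution with \<open>n\<close> degrees
  of freedom, and the bound is its moment generating function at \<open>\<mu>\<close>; shorter vectors have a smaller one.\<close>

lemma nn_integral_exp_gaussian_norm_le:
  assumes z: "norm z \<le> 1" and \<mu>: "0 \<le> \<mu>" "2 * \<mu> < 1"
  shows "(\<integral>\<^sup>+\<omega>. ennreal (exp (\<mu> / \<sigma>\<^sup>2 * (norm (z v* E \<omega>))\<^sup>2)) \<partial>M)
    \<le> ennreal ((1 / sqrt (1 - 2 * \<mu>)) ^ CARD('n))"
proof (cases "z = 0")
  case True
  have "1 \<le> 1 / sqrt (1 - 2 * \<mu>)" using \<mu> by simp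
  hence "1 \<le> (1 / sqrt (1 - 2 * \<mu>)) ^ CARD('n)" by (rule one_le_power)
  moreover have "(\<integral>\<^sup>+\<omega>. ennreal (exp (\<mu> / \<sigma>\<^sup>2 * (norm (z v* E \<omega>))\<^sup>2)) \<partial>M) = 1"
    using True by (simp add: emeasure_space_1)
  ultimately show ?thesis by simp
next
  case False
  let ?X = "\<lambda>j \<omega>. (z v* E \<omega>) $ j"
  have z2: "\<mu> * (norm z)\<^sup>2 \<le> \<mu> * 1"
    using z \<mu> by (intro mult_left_mono) (auto simp: power_le_one)
  have \<tau>: "2 * (\<mu> / \<sigma>\<^sup>2) * (\<sigma> * norm z)\<^sup>2 = 2 * \<mu> * (norm z)\<^sup>2"
    using \<sigma> by (simp add: power_mult_distrib)
  have "(\<integral>\<^sup>+\<omega>. ennreal (exp (\<mu> / \<sigma>\<^sup>2 * (norm (z v* E \<omega>))\<^sup>2)) \<partial>M)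
      = (\<integral>\<^sup>+\<omega>. (\<Prod>j\<in>UNIV. ennreal (exp (\<mu> / \<sigma>\<^sup>2 * (?X j \<omega>)\<^sup>2))) \<partial>M)"
    by (simp add: norm_vec_def L2_set_def sum_nonneg sum_distrib_left exp_sum prod_ennreal)
  also have "\<dots> = (\<Prod>j\<in>UNIV. \<integral>\<^sup>+\<omega>. ennreal (exp (\<mu> / \<sigma>\<^sup>2 * (?X j \<omega>)\<^sup>2)) \<partial>M)"
    by (intro indep_vars_nn_integral indep_vars_compose2[OF indep_vars_column_combinations]) auto
  also have "\<dots> = (\<Prod>j\<in>(UNIV::'n set). ennreal (1 / sqrt (1 - 2 * \<mu> * (norm z)\<^sup>2)))"
  proof (rule prod.cong[OF refl])
    fix j :: 'n
    have "(\<integral>\<^sup>+\<omega>. ennreal (exp (\<mu> / \<sigma>\<^sup>2 * (?X j \<omega>)\<^sup>2)) \<partial>M)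
        = (\<integral>\<^sup>+x. ennreal (normal_density 0 (\<sigma> * norm z) x) * ennreal (exp (\<mu> / \<sigma>\<^sup>2 * x\<^sup>2)) \<partial>lborel)"
      by (rule distributed_nn_integral[OF distributed_entry_combination[OF False], symmetric]) simp
    also have "\<dots> = ennreal (1 / sqrt (1 - 2 * (\<mu> / \<sigma>\<^sup>2) * (\<sigma> * norm z)\<^sup>2))"
      by (rule nn_integral_normal_exp_square) (use \<sigma> \<tau> z2 \<mu> False in auto)
    finally show "(\<integral>\<^sup>+\<omega>. ennreal (exp (\<mu> / \<sigma>\<^sup>2 * (?X j \<omega>)\<^sup>2)) \<partial>M)
        = ennreal (1 / sqrt (1 - 2 * \<mu> * (norm z)\<^sup>2))"
      unfolding \<tau> .
  qed
  also have "\<dots> = ennreal ((1 / sqrt (1 - 2 * \<mu> * (norm z)\<^sup>2)) ^ CARD('n))"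
    using z2 \<mu> by (simp add: ennreal_power)
  also have "\<dots> \<le> ennreal ((1 / sqrt (1 - 2 * \<mu>)) ^ CARD('n))"
    using z2 \<mu> by (intro ennreal_leI power_mono divide_left_mono mult_pos_pos) auto
  finally show ?thesis .
qed

text \<open>At the reduced rate \<open>\<mu> (1 - \<epsilon>)\<^sup>2\<close>, the exponentials of \<open>\<parallel>w v* E\<parallel>\<^sup>2 / \<sigma>\<^sup>2\<close> for all unit vectors \<open>w\<close> of
  \<open>V\<^sub>K\<close> are dominated by one random variable \<open>Z\<close>, whose mean is at most \<open>\<epsilon>\<^sup>-\<^sup>k\<close>, with \<open>k = card K\<close>, times the
  moment of a single vector at the rate \<open>\<mu>\<close>.\<close>

lemma subspace_exp_moment:
  fixes X :: "real^'p^'m"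
  assumes \<epsilon>: "0 < \<epsilon>" "\<epsilon> \<le> 1" and \<mu>: "0 \<le> \<mu>" "2 * \<mu> < 1"
  obtains Z where "Z \<in> borel_measurable M"
    "\<And>\<omega> w. w \<in> column_span X K \<Longrightarrow> norm w = 1
      \<Longrightarrow> ennreal (exp (\<mu> / \<sigma>\<^sup>2 * (1 - \<epsilon>)\<^sup>2 * (norm (w v* E \<omega>))\<^sup>2)) \<le> Z \<omega>"
    "(\<integral>\<^sup>+\<omega>. Z \<omega> \<partial>M) \<le> ennreal ((1 / \<epsilon>) ^ card K * (1 / sqrt (1 - 2 * \<mu>)) ^ CARD('n))"
proof -
  obtain h :: "real^'p \<Rightarrow> real^'m" where h: "linear h" "\<And>c. h c = h (coord_proj K c)"
    "\<And>c. norm (h c) \<le> norm (coord_proj K c)"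
    "\<And>z. z \<in> column_span X K \<Longrightarrow> \<exists>c. coord_proj K c = c \<and> norm c \<le> norm z \<and> h c = z"
    using column_span_parametrization[where X = X and K = K] by metis
  define f where "f \<omega> c = ennreal (exp (\<mu> / \<sigma>\<^sup>2 * (norm (h c v* E \<omega>))\<^sup>2)) * indicator (cylinder K) c"
    for \<omega> c
  define v where "v = emeasure lborel (cylinder K :: (real^'p) set)"
  define a where "a = ennreal (\<epsilon> ^ card K) * v"
  have v: "v \<noteq> 0" "v \<noteq> top"
    using emeasure_cylinder_pos[of K] emeasure_cylinder_finite[of K] by (auto simp: v_def)
  have a: "a \<noteq> 0" "a \<noteq> top"
    using v \<epsilon> by (auto simp: a_def ennreal_mult_eq_top_iff)
  have [measurable]: "(\<lambda>c. h c $ i) \<in> borel_measurable borel" for i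
    by (intro borel_measurable_continuous_onI continuous_intros linear_continuous_on)
       (use h(1) linear_linear in blast)
  have f_eq: "f \<omega> c = ennreal (exp (\<mu> / \<sigma>\<^sup>2 * (\<Sum>j\<in>UNIV. (\<Sum>i\<in>UNIV. E \<omega> $ i $ j * h c $ i)\<^sup>2)))
      * indicator (cylinder K) c" for \<omega> c
    by (simp add: f_def norm_vec_def L2_set_def sum_nonneg vector_matrix_mult_def mult.commute)
  have f_meas[measurable]: "(\<lambda>(\<omega>, c). f \<omega> c) \<in> borel_measurable (M \<Otimes>\<^sub>M lborel)"
    unfolding f_eq by measurable
  interpret P: pair_sigma_finite M "lborel :: (real^'p) measure" ..
  \<comment> \<open>The average over the cylinder, divided by the volume factor \<open>\<epsilon>\<^sup>k\<close>; unlike a supremum it is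
    visibly measurable and its mean is computed by exchanging integrals.\<close>
  define Z where "Z \<omega> = (\<integral>\<^sup>+c. f \<omega> c \<partial>lborel) / a" for \<omega>
  have Z_meas: "Z \<in> borel_measurable M"
    unfolding Z_def by measurable
  moreover have "ennreal (exp (\<mu> / \<sigma>\<^sup>2 * (1 - \<epsilon>)\<^sup>2 * (norm (w v* E \<omega>))\<^sup>2)) \<le> Z \<omega>"
    if w: "w \<in> column_span X K" "norm w = 1" for \<omega> w
  proof -
    obtain c where c: "coord_proj K c = c" "norm c \<le> norm w" "h c = w" using h(4)[OF w(1)] by blast
    have lin: "linear (\<lambda>c. h c v* E \<omega>)"
      by (rule linearI) (simp_all add: linear_add[OF h(1)] linear_scale[OF h(1)]
          vector_matrix_left_distrib scaleR_vector_matrix_assoc)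
    have "ennreal (\<epsilon> ^ card K) * (ennreal (exp (\<mu> / \<sigma>\<^sup>2 * (1 - \<epsilon>)\<^sup>2 * (norm (h c v* E \<omega>))\<^sup>2)) * v)
        \<le> (\<integral>\<^sup>+c. f \<omega> c \<partial>lborel)"
      unfolding f_def v_def
      by (rule exp_quadratic_le_cylinder_average[OF lin])
         (use c w \<epsilon> \<mu> h(2) in auto)
    hence "ennreal (exp (\<mu> / \<sigma>\<^sup>2 * (1 - \<epsilon>)\<^sup>2 * (norm (w v* E \<omega>))\<^sup>2)) * a \<le> (\<integral>\<^sup>+c. f \<omega> c \<partial>lborel)"
      by (simp only: a_def c mult_ac)
    hence "ennreal (exp (\<mu> / \<sigma>\<^sup>2 * (1 - \<epsilon>)\<^sup>2 * (norm (w v* E \<omega>))\<^sup>2)) * a / a \<le> Z \<omega>"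
      unfolding Z_def by (rule divide_right_mono_ennreal)
    thus ?thesis using a by (simp add: ennreal_mult_divide_eq)
  qed
  moreover have "(\<integral>\<^sup>+\<omega>. Z \<omega> \<partial>M) \<le> ennreal ((1 / \<epsilon>) ^ card K * (1 / sqrt (1 - 2 * \<mu>)) ^ CARD('n))"
  proof -
    let ?b = "(1 / sqrt (1 - 2 * \<mu>)) ^ CARD('n)"
    have "(\<integral>\<^sup>+\<omega>. Z \<omega> \<partial>M) = (\<integral>\<^sup>+\<omega>. (\<integral>\<^sup>+c. f \<omega> c \<partial>lborel) \<partial>M) / a"
      unfolding Z_def by (rule nn_integral_divide) measurable
    also have "(\<integral>\<^sup>+\<omega>. (\<integral>\<^sup>+c. f \<omega> c \<partial>lborel) \<partial>M) = (\<integral>\<^sup>+c. (\<integral>\<^sup>+\<omega>. f \<omega> c \<partial>M) \<partial>lborel)"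
      using P.Fubini'[of f] f_meas by simp
    also have "\<dots> \<le> (\<integral>\<^sup>+c. ennreal ?b * indicator (cylinder K) c \<partial>lborel)"
    proof (rule nn_integral_mono)
      fix c :: "real^'p"
      show "(\<integral>\<^sup>+\<omega>. f \<omega> c \<partial>M) \<le> ennreal ?b * indicator (cylinder K) c"
      proof (cases "c \<in> cylinder K")
        case True
        hence "norm (h c) \<le> 1" using h(3)[of c] by (simp add: cylinder_def)
        from nn_integral_exp_gaussian_norm_le[OF this \<mu>] show ?thesis
          using True by (simp add: f_def)
      qed (simp add: f_def)
    qed
    also have "\<dots> = ennreal ?b * v"
      unfolding v_def by (rule nn_integral_cmult_indicator) simp
    also have "ennreal ?b * v / a = ennreal ((1 / \<epsilon>) ^ card K * ?b)"
    proof -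
      have "ennreal ((1 / \<epsilon>) ^ card K * ?b) * a = ennreal ((1 / \<epsilon>) ^ card K * ?b * \<epsilon> ^ card K) * v"
        unfolding a_def using \<epsilon> \<mu> by (simp add: ennreal_mult[symmetric] mult.assoc[symmetric])
      also have "(1 / \<epsilon>) ^ card K * ?b * \<epsilon> ^ card K = ?b"
        using \<epsilon> by (simp add: power_one_over field_simps)
      finally show ?thesis using a by (metis ennreal_mult_divide_eq)
    qed
    finally show ?thesis by (simp add: divide_right_mono_ennreal)
  qed
  ultimately show thesis by (rule that)
qed

text \<open>The excess over the thresholds, simultaneously for all \<open>K\<close>, is dominated by a random variable with
  mean of order \<open>\<sigma>\<^sup>2 exp (- n / 2)\<close>. The bound \<open>u \<le> exp (u - 1)\<close> turns the excess into the exponential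
  moment of the preceding lemma. Of the threshold, the part \<open>4 n\<close> pays for \<open>exp (7 n / 2)\<close> from the
  moment generating function and leaves \<open>exp (- n / 2)\<close>, the part \<open>log (2 e)\<close> per index pays for the
  factor \<open>1 / \<epsilon>\<close>, and the entropy part pays for the number of sets \<open>K\<close>.\<close>

lemma noise_remainder:
  fixes X :: "real^'p^'m"
  obtains R where "R \<in> borel_measurable M"
    "\<And>\<omega> K w. w \<in> column_span X K \<Longrightarrow> norm w = 1
      \<Longrightarrow> ennreal ((norm (w v* E \<omega>))\<^sup>2 - noise_threshold \<sigma> CARD('n) K) \<le> R \<omega>"
    "(\<integral>\<^sup>+\<omega>. R \<omega> \<partial>M) \<le> ennreal (810/13 * \<sigma>\<^sup>2 * exp (-1) * exp (- real CARD('n) / 2))"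
proof -
  define \<epsilon> :: real where "\<epsilon> = 197/1000"
  define \<mu> where "\<mu> = 26/81 / (1 - \<epsilon>)\<^sup>2"
  define b where "b = 1 / sqrt (1 - 2 * \<mu>)"
  define g where "g = 81/26 * \<sigma>\<^sup>2"
  let ?n = "CARD('n)" and ?p = "CARD('p)"
  have \<epsilon>: "0 < \<epsilon>" "\<epsilon> \<le> 1" and \<mu>0: "0 \<le> \<mu>" and g: "0 \<le> g" by (simp_all add: \<epsilon>_def \<mu>_def g_def)
  have \<mu>1: "2 * \<mu> < 1" and b: "b \<le> exp (7/2)" and \<epsilon>_inv: "1 / \<epsilon> \<le> 20/21 * (2 * exp 1)"
    unfolding b_def \<mu>_def \<epsilon>_def by (rule exp_moment_constants)+
  have b0: "0 \<le> b" using \<mu>1 by (simp add: b_def)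
  have rate: "\<mu> / \<sigma>\<^sup>2 * (1 - \<epsilon>)\<^sup>2 = 1 / g"
    by (simp add: \<mu>_def \<epsilon>_def g_def)
  have "\<exists>Z. Z \<in> borel_measurable M
      \<and> (\<forall>\<omega> w. w \<in> column_span X K \<longrightarrow> norm w = 1 \<longrightarrow> ennreal (exp (1 / g * (norm (w v* E \<omega>))\<^sup>2)) \<le> Z \<omega>)
      \<and> (\<integral>\<^sup>+\<omega>. Z \<omega> \<partial>M) \<le> ennreal ((1 / \<epsilon>) ^ card K * b ^ ?n)" for K
    unfolding rate[symmetric] b_def using subspace_exp_moment[OF \<epsilon> \<mu>0 \<mu>1, where X = X and K = K]
    by metis
  then obtain Z where Z[measurable]: "\<And>K. Z K \<in> borel_measurable M"
    and Z_ge: "\<And>K \<omega> w. w \<in> column_span X K \<Longrightarrow> norm w = 1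
      \<Longrightarrow> ennreal (exp (1 / g * (norm (w v* E \<omega>))\<^sup>2)) \<le> Z K \<omega>"
    and Z_int: "\<And>K. (\<integral>\<^sup>+\<omega>. Z K \<omega> \<partial>M) \<le> ennreal ((1 / \<epsilon>) ^ card K * b ^ ?n)"
    by metis
  define a where "a K = g * exp (- 1 - (4 * real ?n + pen_rate K))" for K :: "'p set"
  have a: "0 \<le> a K" for K using g by (simp add: a_def)
  define R where "R \<omega> = (\<Sum>K\<in>UNIV - {{}}. ennreal (a K) * Z K \<omega>)" for \<omega>
  have "R \<in> borel_measurable M"
    unfolding R_def by measurable
  moreover have "ennreal ((norm (w v* E \<omega>))\<^sup>2 - noise_threshold \<sigma> ?n K) \<le> R \<omega>"
    if w: "w \<in> column_span X K" "norm w = 1" for \<omega> K w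
  proof -
    have "K \<noteq> {}" using w by (auto simp: column_span_def)
    let ?Q = "(norm (w v* E \<omega>))\<^sup>2"
    define u where "u = 1 / g * ?Q - (4 * real ?n + pen_rate K)"
    have "?Q - noise_threshold \<sigma> ?n K = g * u"
      using \<sigma> by (simp add: u_def g_def noise_threshold_def field_simps)
    also have "\<dots> \<le> g * exp (u - 1)"
      using exp_ge_add_one_self[of "u - 1"] g by (intro mult_left_mono) auto
    also have "\<dots> = a K * exp (1 / g * ?Q)"
      unfolding a_def u_def mult.assoc exp_add[symmetric] by (simp add: algebra_simps)
    finally have "ennreal (?Q - noise_threshold \<sigma> ?n K) \<le> ennreal (a K) * ennreal (exp (1 / g * ?Q))"
      using a by (simp add: ennreal_mult[symmetric] ennreal_leI)
    also have "\<dots> \<le> ennreal (a K) * Z K \<omega>"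
      by (intro mult_left_mono Z_ge w) auto
    also have "\<dots> \<le> R \<omega>"
      unfolding R_def by (rule member_le_sum) (use \<open>K \<noteq> {}\<close> in auto)
    finally show ?thesis .
  qed
  moreover have "(\<integral>\<^sup>+\<omega>. R \<omega> \<partial>M) \<le> ennreal (810/13 * \<sigma>\<^sup>2 * exp (-1) * exp (- real ?n / 2))"
  proof -
    let ?L = "\<lambda>K :: 'p set. entropy_bound (real ?p) (real (card K))"
    define C where "C = g * exp (-1) * exp (- real ?n / 2)"
    have C: "0 \<le> C" using g by (simp add: C_def)
    have term_le: "a K * ((1 / \<epsilon>) ^ card K * b ^ ?n) \<le> C * ((20/21) ^ card K * exp (- ?L K))" for K
    proof -
      have "(1 / \<epsilon>) ^ card K * b ^ ?n \<le> (20/21 * (2 * exp 1)) ^ card K * exp (7/2) ^ ?n"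
        using \<epsilon> b0 by (intro mult_mono power_mono \<epsilon>_inv b) auto
      hence "a K * ((1 / \<epsilon>) ^ card K * b ^ ?n) \<le> a K * ((20/21 * (2 * exp 1)) ^ card K * exp (7/2) ^ ?n)"
        by (rule mult_left_mono) (rule a)
      also have "\<dots> = C * ((20/21) ^ card K * exp (- ?L K))"
      proof -
        have pow: "(2 * exp (1::real)) ^ card K = exp (real (card K) * ln (2 * exp 1))"
          by (simp add: exp_of_nat_mult)
        have pow': "exp (7/2 :: real) ^ ?n = exp (real ?n * (7/2))"
          by (simp only: exp_of_nat_mult)
        have "exp (- 1 - (4 * real ?n + pen_rate K)) * exp (real (card K) * ln (2 * exp 1)) * exp (real ?n * (7/2))
            = exp (-1) * exp (- real ?n / 2) * exp (- ?L K)"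
          unfolding exp_add[symmetric] pen_rate_def by (simp add: algebra_simps)
        thus ?thesis
          unfolding a_def C_def power_mult_distrib[of "20/21" "2 * exp 1"] pow pow'
          by (simp only: mult_ac) (simp add: mult.left_commute mult.assoc)
      qed
      finally show ?thesis .
    qed
    have "(\<integral>\<^sup>+\<omega>. R \<omega> \<partial>M) = (\<Sum>K\<in>UNIV - {{}}. ennreal (a K) * (\<integral>\<^sup>+\<omega>. Z K \<omega> \<partial>M))"
      unfolding R_def by (subst nn_integral_sum) (auto simp: nn_integral_cmult)
    also have "\<dots> \<le> (\<Sum>K\<in>UNIV - {{}}. ennreal (a K) * ennreal ((1 / \<epsilon>) ^ card K * b ^ ?n))"
      by (intro sum_mono mult_left_mono Z_int) auto
    also have "\<dots> = ennreal (\<Sum>K\<in>UNIV - {{}}. a K * ((1 / \<epsilon>) ^ card K * b ^ ?n))"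
      using a \<epsilon> b0 by (subst sum_ennreal[symmetric]) (auto simp: ennreal_mult intro!: mult_nonneg_nonneg)
    also have "\<dots> \<le> ennreal (C * 20)"
    proof (rule ennreal_leI)
      have "(\<Sum>K\<in>UNIV - {{}}. a K * ((1 / \<epsilon>) ^ card K * b ^ ?n))
          \<le> C * (\<Sum>K\<in>UNIV - {{} :: 'p set}. (20/21) ^ card K * exp (- ?L K))"
        unfolding sum_distrib_left by (intro sum_mono term_le)
      also have "\<dots> \<le> C * ((20/21) / (1 - 20/21))"
        by (intro mult_left_mono sum_subsets_entropy_weight_le C) auto
      finally show "(\<Sum>K\<in>UNIV - {{}}. a K * ((1 / \<epsilon>) ^ card K * b ^ ?n)) \<le> C * 20" by simp
    qed
    finally show ?thesis by (simp add: C_def g_def mult_ac)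
  qed
  ultimately show thesis by (rule that)
qed

end

end

section \<open>The oracle inequality in expectation\<close>

text \<open>Subadditivity of the integral with only one of the two functions measurable; it
  spares a proof that the penalty, which involves the rank, is a measurable function.\<close>

lemma nn_integral_add_cmult_le:
  fixes f g :: "'a \<Rightarrow> ennreal"
  assumes f: "f \<in> borel_measurable M" and c: "c \<noteq> 0" "c \<noteq> top"
  shows "(\<integral>\<^sup>+x. f x + c * g x \<partial>M) \<le> (\<integral>\<^sup>+x. f x \<partial>M) + c * (\<integral>\<^sup>+x. g x \<partial>M)"
proof -
  have "integral\<^sup>S M s \<le> (\<integral>\<^sup>+x. f x \<partial>M) + c * (\<integral>\<^sup>+x. g x \<partial>M)"
    if s: "simple_function M s" "s \<le> (\<lambda>x. f x + c * g x)" "\<And>x. s x < top" for s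
  proof -
    have s_meas: "s \<in> borel_measurable M" using s(1) by (rule borel_measurable_simple_function)
    define u where "u x = (s x - f x) / c" for x
    have u_meas: "u \<in> borel_measurable M"
      unfolding u_def using s_meas f by measurable
    have cu: "c * u x = s x - f x" for x
      unfolding u_def using c
      by (simp add: ennreal_times_divide mult.commute[of c] ennreal_mult_divide_eq)
    have "u x \<le> g x" for x
    proof -
      have "s x - f x \<le> g x * c"
        using s(2) s(3)[of x] by (auto simp: le_fun_def ennreal_minus_le_iff mult.commute)
      hence "u x \<le> g x * c / c"
        unfolding u_def by (rule divide_right_mono_ennreal)
      thus ?thesis using c by (simp add: ennreal_mult_divide_eq)
    qed
    moreover have "s x \<le> f x + c * u x" for x
      unfolding cu by (metis ennreal_minus_le_iff order_refl)
    ultimately have "integral\<^sup>N M s \<le> (\<integral>\<^sup>+x. f x + c * u x \<partial>M)" "(\<integral>\<^sup>+x. u x \<partial>M) \<le> (\<integral>\<^sup>+x. g x \<partial>M)"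
      by (auto intro!: nn_integral_mono)
    moreover have "(\<integral>\<^sup>+x. f x + c * u x \<partial>M) = (\<integral>\<^sup>+x. f x \<partial>M) + c * (\<integral>\<^sup>+x. u x \<partial>M)"
      using f u_meas by (simp add: nn_integral_add nn_integral_cmult)
    ultimately show ?thesis
      unfolding nn_integral_eq_simple_integral[OF s(1), symmetric]
      by (metis add_left_mono mult_left_mono order_trans zero_le)
  qed
  thus ?thesis
    unfolding nn_integral_def_finite[of M "\<lambda>x. f x + c * g x"] by (intro SUP_least) auto
qed

theorem theorem2:
  fixes M :: "'w measure"
    and X :: "real^'p^'m" and A :: "real^'n^'p"
    and E Y :: "'w \<Rightarrow> real^'n^'m" and \<sigma> :: real
    and I :: "'i set" and B :: "'i \<Rightarrow> 'w \<Rightarrow> real^'n^'p"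
    and Bt :: "'w \<Rightarrow> real^'n^'p"
  assumes "prob_space M"
    and "\<sigma> > 0"
    and "prob_space.indep_vars M (\<lambda>_. borel) (\<lambda>(i, j) \<omega>. E \<omega> $ i $ j) UNIV"
    and "\<And>i j. distributed M lborel (\<lambda>\<omega>. E \<omega> $ i $ j) (normal_density 0 \<sigma>)"
    and "\<And>\<omega>. \<omega> \<in> space M \<Longrightarrow> Y \<omega> = X ** A + E \<omega>"
    and "countable I"
    and "\<And>j. j \<in> I \<Longrightarrow> B j \<in> borel_measurable M"
    and "\<And>j. j \<in> I \<Longrightarrow> AE \<omega> in M. B j \<omega> \<noteq> 0"
    and "Bt \<in> borel_measurable M"
    and "AE \<omega> in M. is_arg_min (\<lambda>C. (norm (Y \<omega> - X ** C))\<^sup>2 + pen 12 \<sigma> C)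
           (\<lambda>C. C \<in> (\<lambda>j. B j \<omega>) ` I) (Bt \<omega>)"
  shows "(\<integral>\<^sup>+ \<omega>. ennreal ((norm (X ** A - X ** Bt \<omega>))\<^sup>2) \<partial>M)
    \<le> (INF j\<in>I. 10 * (\<integral>\<^sup>+ \<omega>. ennreal ((norm (X ** A - X ** B j \<omega>))\<^sup>2) \<partial>M)
                + 8 * (\<integral>\<^sup>+ \<omega>. ennreal (pen 12 \<sigma> (B j \<omega>)) \<partial>M))
      + ennreal (768 * real CARD('n) * \<sigma>\<^sup>2 * exp (- real CARD('n) / 2))"
    (is "?lhs \<le> (INF j\<in>I. ?rhs j) + ennreal ?rem")
proof -
  let ?n = "real CARD('n)"
  obtain R where R: "R \<in> borel_measurable M"
    "\<And>\<omega> K w. w \<in> column_span X K \<Longrightarrow> norm w = 1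
      \<Longrightarrow> ennreal ((norm (w v* E \<omega>))\<^sup>2 - noise_threshold \<sigma> CARD('n) K) \<le> R \<omega>"
    "(\<integral>\<^sup>+\<omega>. R \<omega> \<partial>M) \<le> ennreal (810/13 * \<sigma>\<^sup>2 * exp (-1) * exp (- ?n / 2))"
    using prob_space.noise_remainder[OF assms(1-4), where X = X] by metis
  have "?lhs \<le> ?rhs j + ennreal ?rem" if j: "j \<in> I" for j
  proof -
    let ?loss = "\<lambda>C. (norm (X ** A - X ** C))\<^sup>2"
    have [measurable]: "(\<lambda>\<omega>. ?loss (B j \<omega>)) \<in> borel_measurable M"
      by (rule borel_measurable_continuous_on[OF _ assms(7)[OF j]])
         (simp add: matrix_matrix_mult_def, intro continuous_intros)
    let ?f = "\<lambda>\<omega>. 10 * ennreal (?loss (B j \<omega>)) + ennreal (338/27 * ?n) * R \<omega>"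
    have "AE \<omega> in M. ennreal (?loss (Bt \<omega>)) \<le> ?f \<omega> + 8 * ennreal (pen 12 \<sigma> (B j \<omega>))"
      using assms(10) AE_space
    proof eventually_elim
      case (elim \<omega>)
      show ?case
      \<comment> \<open>Where \<open>R\<close> is infinite, so is the right-hand side, because \<open>n > 0\<close>.\<close>
      proof (cases "R \<omega>")
        case (real \<rho>)
        have "(norm (w v* E \<omega>))\<^sup>2 \<le> noise_threshold \<sigma> CARD('n) K + \<rho>"
          if "w \<in> column_span X K" "norm w = 1" for K w
          using R(2)[OF that, of \<omega>] real by (simp add: algebra_simps)
        moreover have "(norm (X ** A + E \<omega> - X ** Bt \<omega>))\<^sup>2 + pen 12 \<sigma> (Bt \<omega>)
            \<le> (norm (X ** A + E \<omega> - X ** B j \<omega>))\<^sup>2 + pen 12 \<sigma> (B j \<omega>)"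
          using elim j assms(5) by (auto simp: is_arg_min_def not_less)
        ultimately have "?loss (Bt \<omega>) \<le> 10 * ?loss (B j \<omega>) + 8 * pen 12 \<sigma> (B j \<omega>) + 338/27 * ?n * \<rho>"
          using real by (intro penalized_minimizer_loss_le[where E = "E \<omega>"]) auto
        hence "ennreal (?loss (Bt \<omega>))
            \<le> ennreal (10 * ?loss (B j \<omega>) + 8 * pen 12 \<sigma> (B j \<omega>) + 338/27 * ?n * \<rho>)"
          by (rule ennreal_leI)
        also have "\<dots> = ennreal (10 * ?loss (B j \<omega>)) + ennreal (8 * pen 12 \<sigma> (B j \<omega>))
            + ennreal (338/27 * ?n * \<rho>)"
          using real(1) pen_nonneg[of 12 \<sigma> "B j \<omega>"] by simp
        also have "ennreal (338/27 * ?n * \<rho>) = ennreal (338/27 * ?n) * R \<omega>"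
          unfolding real(2) by (rule ennreal_mult) (use real(1) in auto)
        also have "ennreal (10 * ?loss (B j \<omega>)) + ennreal (8 * pen 12 \<sigma> (B j \<omega>))
            + ennreal (338/27 * ?n) * R \<omega> = ?f \<omega> + 8 * ennreal (pen 12 \<sigma> (B j \<omega>))"
          by (simp add: ennreal_mult' add_ac)
        finally show ?thesis .
      next
        case top
        thus ?thesis by (simp add: ennreal_mult_top)
      qed
    qed
    hence "?lhs \<le> (\<integral>\<^sup>+\<omega>. ?f \<omega> + 8 * ennreal (pen 12 \<sigma> (B j \<omega>)) \<partial>M)"
      by (rule nn_integral_mono_AE)
    also have "\<dots> \<le> (\<integral>\<^sup>+\<omega>. ?f \<omega> \<partial>M) + 8 * (\<integral>\<^sup>+\<omega>. ennreal (pen 12 \<sigma> (B j \<omega>)) \<partial>M)"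
      by (rule nn_integral_add_cmult_le) (use R(1) in auto)
    also have "(\<integral>\<^sup>+\<omega>. ?f \<omega> \<partial>M) = 10 * (\<integral>\<^sup>+\<omega>. ennreal (?loss (B j \<omega>)) \<partial>M)
        + ennreal (338/27 * ?n) * (\<integral>\<^sup>+\<omega>. R \<omega> \<partial>M)"
      using R(1) by (simp add: nn_integral_add nn_integral_cmult)
    also have "ennreal (338/27 * ?n) * (\<integral>\<^sup>+\<omega>. R \<omega> \<partial>M)
        \<le> ennreal (338/27 * ?n) * ennreal (810/13 * \<sigma>\<^sup>2 * exp (-1) * exp (- ?n / 2))"
      by (intro mult_left_mono R(3)) auto
    also have "\<dots> = ennreal (780 * ?n * \<sigma>\<^sup>2 * exp (-1) * exp (- ?n / 2))"
      by (simp add: ennreal_mult[symmetric])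
    also have "\<dots> \<le> ennreal ?rem"
    proof (rule ennreal_leI)
      have "780 * exp (-1 :: real) \<le> 768"
        using exp_1_ge by (simp add: exp_minus field_simps)
      hence "780 * exp (-1) * (?n * \<sigma>\<^sup>2 * exp (- ?n / 2)) \<le> 768 * (?n * \<sigma>\<^sup>2 * exp (- ?n / 2))"
        by (intro mult_right_mono) auto
      thus "780 * ?n * \<sigma>\<^sup>2 * exp (-1) * exp (- ?n / 2) \<le> ?rem"
        by (simp only: mult_ac)
    qed
    finally show ?thesis by (simp add: add_ac)
  qed
  hence "?lhs - ennreal ?rem \<le> ?rhs j" if "j \<in> I" for j
    using that by (simp add: ennreal_minus_le_iff add.commute)
  hence "?lhs - ennreal ?rem \<le> (INF j\<in>I. ?rhs j)"
    by (rule INF_greatest)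
  thus ?thesis
    by (simp add: ennreal_minus_le_iff add.commute)
qed

end
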